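(* Let $d\in\mathbb{N}$ and let $K\subset\mathbb{R}^d$ be non-empty, compact and self-embeddable. Then: (i) $\overline{\dim}_B K\leq\dim_A(K,x)$ for all $x\in K$. (ii) There is a dense set $P\subset K$ such that for each $x\in P$ there is an $F\in\operatorname{Tan}(K,x)$ so that $\mathcal{H}^{\dim_A K}(F)\geq 2^{-\dim_A K}$. In particular, $$\dim_P\{x\in K:\dim_A(K,x)=\dim_A K\}=\dim_P K.$$ If moreover $K$ is uniformly self-embeddable, then there is a constant $c>0$ so that $$\dim_H\{x\in K:\exists F\in\operatorname{Tan}(K,x)\text{ with }\mathcal{H}^{\dim_A K}(F)\geq c\}=\dim_H K.$$
   Context: $\mathbb{R}^d$ has the Euclidean metric and $B(x,r)$ is the closed ball with centre $x$ and radius $r$. $\dim_H$, $\dim_P$, $\overline{\dim}_B$ denote Hausdorff, packing and upper box dimension, and $\mathcal{H}^s$ is $s$-dimensional Hausdorff measure, defined using sums $\sum_i(\operatorname{diam} U_i)^s$ (no further normalizing constant). A compact set $K$ is self-embeddable if for each $z\in K$ and $0<r\leq\operatorname{diam} K$ there is a constant $a=a(z,r)>0$ and a function $f\colon K\to B(z,r)\cap K$ so that $$a r|x-y|\leq |f(x)-f(y)|\leq a^{-1}r|x-y|\qquad\text{for all }x,y\in K.$$ $K$ is uniformly self-embeddable if the constant $a(z,r)$ can be chosen independently of $z$ and $r$. For a bounded set $E$, $N_r(E)$ is the smallest number of closed balls of radius $r$ needed to cover $E$. The Assouad dimension of $K$, and the pointwise Assouad dimension of $K$ at $x\in K$, are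 $$\dim_A K=\inf\Bigl\{s:\exists C>0\ \forall\,0<r\leq R<1\ \forall x\in K,\ N_r(B(x,R)\cap K)\leq C\Bigl(\frac{R}{r}\Bigr)^s\Bigr\},$$ $$\dim_A(K,x)=\inf\Bigl\{s:\exists C>0\ \exists\rho>0\ \forall\,0<r\leq R<\rho,\ N_r(B(x,R)\cap K)\leq C\Bigl(\frac{R}{r}\Bigr)^s\Bigr\}.$$ For $x\in K$, a non-empty compact set $F\subset B(0,1)$ is a tangent of $K$ at $x$, written $F\in\operatorname{Tan}(K,x)$, if there is a sequence $(\lambda_k)_{k=1}^\infty$ of positive reals diverging to infinity such that $F=\lim_{k\to\infty}\lambda_k(K-x)\cap B(0,1)$ in the Hausdorff metric on non-empty compact subsets of $B(0,1)$. *)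

theory Defs
  imports "HOL-Analysis.Analysis"
begin

definition embeds_at_scale :: "'a::metric_space set \<Rightarrow> 'a \<Rightarrow> real \<Rightarrow> real \<Rightarrow> bool" where
  "embeds_at_scale K z r a \<longleftrightarrow>
     (\<exists>f. f ` K \<subseteq> cball z r \<inter> K \<and>
       (\<forall>x\<in>K. \<forall>y\<in>K. a * r * dist x y \<le> dist (f x) (f y) \<and>
                     dist (f x) (f y) \<le> inverse a * r * dist x y))"

definition self_embeddable :: "'a::metric_space set \<Rightarrow> bool" where
  "self_embeddable K \<longleftrightarrow>
     (\<forall>z\<in>K. \<forall>r. 0 < r \<and> r \<le> diameter K \<longrightarrow> (\<exists>a>0. embeds_at_scale K z r a))"

definition uniformly_self_embeddable :: "'a::metric_space set \<Rightarrow> bool" where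
  "uniformly_self_embeddable K \<longleftrightarrow>
     (\<exists>a>0. \<forall>z\<in>K. \<forall>r. 0 < r \<and> r \<le> diameter K \<longrightarrow> embeds_at_scale K z r a)"

(* The centres need not lie in E. Only meaningful if E is totally bounded and r > 0. *)
definition covering_num :: "real \<Rightarrow> 'a::metric_space set \<Rightarrow> nat" where
  "covering_num r E = (LEAST n. \<exists>C. finite C \<and> card C = n \<and> E \<subseteq> (\<Union>c\<in>C. cball c r))"

(* Hausdorff, packing and box dimensions are extended reals. As ln 0 = 0, the empty set has box
   dimension 0; its Hausdorff and packing dimensions are 0 as well. *)
definition upper_box_dim :: "'a::metric_space set \<Rightarrow> ereal" where
  "upper_box_dim E = Limsup (at_right 0) (\<lambda>r. ereal (ln (real (covering_num r E)) / ln (1 / r)))"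

(* Packing dimension as the modified upper box dimension. *)
definition packing_dim :: "'a::metric_space set \<Rightarrow> ereal" where
  "packing_dim E =
     (INF U\<in>{U :: nat \<Rightarrow> 'a set. (\<forall>i. bounded (U i)) \<and> E \<subseteq> (\<Union>i. U i)}.
        SUP i. upper_box_dim (U i))"

(* The s-th power of the diameter. For s = 0 every non-empty set counts 1, singletons included,
   whereas 0 powr 0 = 0; the empty set always counts 0. *)
definition diam_pow :: "real \<Rightarrow> 'a::metric_space set \<Rightarrow> real" where
  "diam_pow s U = (if U = {} then 0 else if s = 0 then 1 else diameter U powr s)"

(* Boundedness is required because diameter is unspecified on unbounded sets. *)
definition hausdorff_premeasure :: "real \<Rightarrow> real \<Rightarrow> 'a::metric_space set \<Rightarrow> ennreal" where
  "hausdorff_premeasure s \<delta> E =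
     (INF U\<in>{U :: nat \<Rightarrow> 'a set. (\<forall>i. bounded (U i) \<and> diameter (U i) \<le> \<delta>) \<and> E \<subseteq> (\<Union>i. U i)}.
        \<Sum>i. ennreal (diam_pow s (U i)))"

definition hausdorff_measure :: "real \<Rightarrow> 'a::metric_space set \<Rightarrow> ennreal" where
  "hausdorff_measure s E = (SUP \<delta>\<in>{0<..}. hausdorff_premeasure s \<delta> E)"

definition hausdorff_dim :: "'a::metric_space set \<Rightarrow> ereal" where
  "hausdorff_dim E = (INF s\<in>{s. 0 \<le> s \<and> hausdorff_measure s E = 0}. ereal s)"

(* For non-empty bounded K in a Euclidean space, and x in K, the sets of exponents in the next two
   definitions are non-empty and bounded below by 0, so the real infima are the intended ones. *)
definition assouad_dim :: "'a::metric_space set \<Rightarrow> real" where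
  "assouad_dim K =
     Inf {s. \<exists>C>0. \<forall>r R. 0 < r \<and> r \<le> R \<and> R < 1 \<longrightarrow>
            (\<forall>x\<in>K. real (covering_num r (cball x R \<inter> K)) \<le> C * (R / r) powr s)}"

definition pointwise_assouad_dim :: "'a::metric_space set \<Rightarrow> 'a \<Rightarrow> real" where
  "pointwise_assouad_dim K x =
     Inf {s. \<exists>C>0. \<exists>\<rho>>0. \<forall>r R. 0 < r \<and> r \<le> R \<and> R < \<rho> \<longrightarrow>
            real (covering_num r (cball x R \<inter> K)) \<le> C * (R / r) powr s}"

(* The Hausdorff metric, intended for non-empty bounded arguments. *)
definition hausdorff_dist :: "'a::metric_space set \<Rightarrow> 'a set \<Rightarrow> real" where
  "hausdorff_dist A B = max (SUP a\<in>A. infdist a B) (SUP b\<in>B. infdist b A)"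

definition Tan :: "'a::real_normed_vector set \<Rightarrow> 'a \<Rightarrow> 'a set set" where
  "Tan K x = {F. F \<noteq> {} \<and> compact F \<and> F \<subseteq> cball 0 1 \<and>
     (\<exists>l :: nat \<Rightarrow> real. (\<forall>k. 0 < l k) \<and> filterlim l at_top sequentially \<and>
        (\<lambda>k. hausdorff_dist ((\<lambda>y. l k *\<^sub>R (y - x)) ` K \<inter> cball 0 1) F) \<longlonglongrightarrow> 0)}"

end

theory Submission
  imports Defs "HOL-Complex_Analysis.Great_Picard" "HOL-Real_Asymp.Real_Asymp"
begin

text \<open>Write \<open>\<alpha>\<close> for the Assouad dimension of \<open>K\<close>. If every small ball centred in a piece \<open>E\<close> of \<open>K\<close> had a
  finite cover by sets of diameters \<open>d i\<close>, at scales boundedly smaller than the radius \<open>R\<close>, with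
  \<open>(\<Sum>i. d i powr s) < R powr s\<close>, then iterating these covers would bound the Assouad dimension of \<open>E\<close>
  by \<open>s\<close>. As \<open>K\<close> embeds in each of its own balls, every ball of \<open>K\<close> therefore contains, for each
  \<open>s < \<alpha>\<close>, arbitrarily small balls that are thick in the sense of having no such cover. A generic
  point of \<open>K\<close> is close to thick balls at infinitely many scales, with \<open>s\<close> tending to \<open>\<alpha>\<close>, and a limit
  of the corresponding magnifications is a tangent of large \<open>\<alpha>\<close>-dimensional measure; the Baire
  category theorem also gives the packing dimension. In the uniform case, embed \<open>K\<close> repeatedly around
  the points of a separated subset of \<open>K\<close>, which gives Cantor sets of dimension close to that of \<open>K\<close>, and
  at very sparse levels pass to the image of a thick ball. A fresh embedding is used at each level, so
  the distortion of the thick balls stays bounded while their sparseness preserves the dimension.\<close>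

section \<open>Covering numbers\<close>

text \<open>The contradiction argument yields thick balls only for exponents below
  \<open>assouad_dim K\<close>. The exponent deficit and the cutoff of the m-th ball are both
  1/(m+1), so both vanish in the tangent and the full exponent is recovered with no loss in the
  constant. Distortion in plain self-embeddability is uncontrolled, but there embeddings only
  transport exponents, for which constants do not matter. A residual set may have small Hausdorff
  dimension, so the uniform case needs an explicit set. Its thick balls are fixed beforehand, with
  radii \<open>R k\<close> that have no lower bound; visiting one shrinks the scale by
  \<open>R k / 2\<close> without branching. The separated set \<open>X\<close> is therefore chosen
  with a surplus, \<open>card X * \<theta> powr u > 1\<close>, already net of the distortion, and
  enough ordinary levels are interposed to repay each visit. An embedding at scale r turns a thick
  ball of radius R into a set thick at radius a r R, which lies within 2 r R / a of every point of
  the Cantor set that passes there. The ratio a^2/2 gives the final constant.\<close>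

lemma covering_num_le:
  assumes "finite C" "E \<subseteq> (\<Union>c\<in>C. cball c r)"
  shows "covering_num r E \<le> card C"
  unfolding covering_num_def using assms by (intro Least_le) blast

lemma covering_num_cover:
  fixes E :: "'a::heine_borel set"
  assumes "bounded E" "r > 0"
  obtains C where "finite C" "card C = covering_num r E" "E \<subseteq> (\<Union>c\<in>C. cball c r)"
proof -
  have "compact (closure E)"
    using assms by (simp add: compact_closure)
  then have "\<exists>k. finite k \<and> closure E \<subseteq> (\<Union>x\<in>k. ball x r)"
    using assms(2) by (simp add: compact_eq_totally_bounded)
  then obtain k where k: "finite k" "closure E \<subseteq> (\<Union>x\<in>k. ball x r)"
    by blast
  have "E \<subseteq> (\<Union>c\<in>k. cball c r)"
  proof
    fix x assume "x \<in> E"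
    then have "x \<in> (\<Union>c\<in>k. ball c r)"
      using k(2) closure_subset[of E] by blast
    then show "x \<in> (\<Union>c\<in>k. cball c r)"
      by force
  qed
  then have "\<exists>n. \<exists>C. finite C \<and> card C = n \<and> E \<subseteq> (\<Union>c\<in>C. cball c r)"
    using k(1) by blast
  then have "\<exists>C. finite C \<and> card C = covering_num r E \<and> E \<subseteq> (\<Union>c\<in>C. cball c r)"
    unfolding covering_num_def by (rule LeastI_ex)
  then show thesis
    using that by blast
qed

lemma covering_num_pos:
  fixes E :: "'a::heine_borel set"
  assumes "bounded E" "r > 0" "E \<noteq> {}"
  shows "1 \<le> covering_num r E"
proof -
  obtain C where C: "finite C" "card C = covering_num r E" "E \<subseteq> (\<Union>c\<in>C. cball c r)"
    using covering_num_cover assms by blast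
  then have "C \<noteq> {}"
    using assms(3) by auto
  then show ?thesis
    using C by (metis One_nat_def Suc_leI card_gt_0_iff)
qed

lemma covering_num_mono:
  fixes E :: "'a::heine_borel set"
  assumes "E \<subseteq> E'" "bounded E'" "r > 0"
  shows "covering_num r E \<le> covering_num r E'"
  using covering_num_cover[OF assms(2,3)] covering_num_le assms(1) by (metis subset_trans)

lemma covering_num_small:
  assumes "\<And>y. y \<in> E \<Longrightarrow> dist x y \<le> r"
  shows "covering_num r E \<le> 1"
proof -
  have "E \<subseteq> (\<Union>c\<in>{x}. cball c r)"
    using assms by auto
  from covering_num_le[OF _ this] show ?thesis
    by simp
qed

lemma covering_num_UN:
  fixes E :: "'a::heine_borel set"
  assumes "finite I" "\<And>i. i \<in> I \<Longrightarrow> bounded (F i)" "r > 0" "E \<subseteq> (\<Union>i\<in>I. F i)"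
  shows "covering_num r E \<le> (\<Sum>i\<in>I. covering_num r (F i))"
proof -
  have "\<forall>i\<in>I. \<exists>C. finite C \<and> card C = covering_num r (F i) \<and> F i \<subseteq> (\<Union>c\<in>C. cball c r)"
    using covering_num_cover assms by metis
  then obtain C where C: "\<And>i. i \<in> I \<Longrightarrow> finite (C i) \<and> card (C i) = covering_num r (F i)
      \<and> F i \<subseteq> (\<Union>c\<in>C i. cball c r)"
    by metis
  have "covering_num r E \<le> card (\<Union>i\<in>I. C i)"
  proof (rule covering_num_le)
    show "finite (\<Union>i\<in>I. C i)"
      using C assms(1) by (intro finite_UN_I) simp_all
    show "E \<subseteq> (\<Union>c\<in>(\<Union>i\<in>I. C i). cball c r)"
    proof
      fix x assume "x \<in> E"
      then obtain i where i: "i \<in> I" "x \<in> F i"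
        using assms(4) by (meson UN_E subsetD)
      then have "x \<in> (\<Union>c\<in>C i. cball c r)"
        using C by (meson subsetD)
      then show "x \<in> (\<Union>c\<in>(\<Union>i\<in>I. C i). cball c r)"
        using i(1) by (meson UN_E UN_I)
    qed
  qed
  also have "\<dots> \<le> (\<Sum>i\<in>I. card (C i))"
    using assms(1) by (rule card_UN_le)
  also have "\<dots> = (\<Sum>i\<in>I. covering_num r (F i))"
    using C by (intro sum.cong) auto
  finally show ?thesis .
qed

text \<open>A cover of \<open>B\<close> is pulled back: two points of \<open>A\<close> whose images
  share a ball of radius r are at distance at most 2r/c. The factor 2 pays for moving the centre
  from the ball in \<open>B\<close> to a point of \<open>A\<close>.\<close>

lemma covering_num_embedding:
  fixes B :: "'b::heine_borel set" and g :: "'a::metric_space \<Rightarrow> 'b"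
  assumes g: "g ` A \<subseteq> B" "\<And>x y. x \<in> A \<Longrightarrow> y \<in> A \<Longrightarrow> c * dist x y \<le> dist (g x) (g y)"
    and "bounded B" "c > 0" "r > 0" "2 * r \<le> c * r'"
  shows "covering_num r' A \<le> covering_num r B"
proof -
  obtain C where C: "finite C" "card C = covering_num r B" "B \<subseteq> (\<Union>c\<in>C. cball c r)"
    using covering_num_cover assms by blast
  define h where "h p = (SOME x. x \<in> A \<and> g x \<in> cball p r)" for p
  have "A \<subseteq> (\<Union>p\<in>h ` C. cball p r')"
  proof
    fix x assume x: "x \<in> A"
    then obtain p where p: "p \<in> C" "g x \<in> cball p r"
      using g(1) C(3) by blast
    then have h: "h p \<in> A \<and> g (h p) \<in> cball p r"
      unfolding h_def using x by (metis (mono_tags, lifting) someI_ex)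
    have "dist (g (h p)) (g x) \<le> 2 * r"
      using h p dist_triangle3[of "g (h p)" "g x" p] by (simp add: dist_commute)
    then have "c * dist (h p) x \<le> c * r'"
      using g(2)[of "h p" x] h x assms by linarith
    then show "x \<in> (\<Union>p\<in>h ` C. cball p r')"
      using p assms by auto
  qed
  then have "covering_num r' A \<le> card (h ` C)"
    using C by (intro covering_num_le) auto
  also have "\<dots> \<le> covering_num r B"
    using C card_image_le by metis
  finally show ?thesis .
qed

text \<open>A ball is covered by m balls of half its radius, with m depending on the space only; k
  halvings give m^k = (2^k)^s for s = log 2 m. This provides a finite admissible exponent for every
  set.\<close>

lemma covering_num_cball_doubling:
  obtains C s :: real where "C > 0" "0 \<le> s"
    "\<And>(x::'a::euclidean_space) r R E. 0 < r \<Longrightarrow> r \<le> R \<Longrightarrow> real (covering_num r (cball x R \<inter> E)) \<le> C * (R / r) powr s"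
proof -
  obtain M where M: "finite M" "card M = covering_num (1/2) (cball (0::'a) 1)"
      "cball (0::'a) 1 \<subseteq> (\<Union>c\<in>M. cball c (1/2))"
    using covering_num_cover[of "cball (0::'a) 1" "1/2"] by auto
  define m where "m = card M"
  have "M \<noteq> {}"
    using M(3) by fastforce
  then have m1: "m \<ge> 1"
    using M(1) m_def by (simp add: Suc_le_eq card_gt_0_iff)
  have step: "covering_num r (cball x R) \<le> m ^ k"
    if "0 < r" "0 < R" "R \<le> 2 ^ k * r" for x :: 'a and r R :: real and k
    using that
  proof (induction k arbitrary: x R)
    case 0
    then show ?case
      using covering_num_small[of "cball x R" x r] by auto
  next
    case (Suc k)
    have "cball x R \<subseteq> (\<Union>c\<in>M. cball (x + R *\<^sub>R c) (R / 2))"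
    proof
      fix y assume "y \<in> cball x R"
      then have "(1 / R) *\<^sub>R (y - x) \<in> cball 0 1"
        using Suc by (simp add: dist_norm norm_minus_commute)
      then obtain c where c: "c \<in> M" "dist c ((1 / R) *\<^sub>R (y - x)) \<le> 1/2"
        using M(3) by (metis (no_types, lifting) UN_E mem_cball subsetD)
      have "dist (x + R *\<^sub>R c) y = norm (R *\<^sub>R (c - (1 / R) *\<^sub>R (y - x)))"
        using Suc by (simp add: dist_norm algebra_simps)
      also have "\<dots> = R * dist c ((1 / R) *\<^sub>R (y - x))"
        using Suc by (simp add: dist_norm)
      also have "\<dots> \<le> R * (1/2)"
        using c Suc by (intro mult_left_mono) auto
      finally show "y \<in> (\<Union>c\<in>M. cball (x + R *\<^sub>R c) (R / 2))"
        using c by auto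
    qed
    then have "covering_num r (cball x R) \<le> (\<Sum>c\<in>M. covering_num r (cball (x + R *\<^sub>R c) (R / 2)))"
      using M Suc by (intro covering_num_UN) auto
    also have "\<dots> \<le> (\<Sum>c\<in>M. m ^ k)"
      using Suc by (intro sum_mono Suc.IH) auto
    finally show ?case
      by (simp add: m_def)
  qed
  define s where "s = log 2 (real m)"
  have s0: "0 \<le> s"
    unfolding s_def using m1 by simp
  have main: "real (covering_num r (cball x R \<inter> E)) \<le> 2 powr s * (R / r) powr s"
    if "0 < r" "r \<le> R" for x :: 'a and r R E
  proof -
    \<comment> \<open>This makes R/r \<le> 2^k \<le> 2R/r; rounding up costs the factor 2^s.\<close>
    define k where "k = nat \<lceil>log 2 (R / r)\<rceil>"
    have l0: "0 \<le> log 2 (R / r)"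
      using that by simp
    have k1: "log 2 (R / r) \<le> k" "k \<le> log 2 (R / r) + 1"
      unfolding k_def using l0 by linarith+
    have "R / r \<le> 2 powr k"
      using k1(1) that by (simp add: log_le_iff)
    then have "R / r \<le> 2 ^ k"
      by (simp add: powr_realpow)
    then have "R \<le> 2 ^ k * r"
      using that by (simp add: pos_divide_le_eq)
    then have "covering_num r (cball x R) \<le> m ^ k"
      using that by (intro step) auto
    moreover have "covering_num r (cball x R \<inter> E) \<le> covering_num r (cball x R)"
      using that by (intro covering_num_mono) auto
    ultimately have "real (covering_num r (cball x R \<inter> E)) \<le> real m ^ k"
      by (metis of_nat_le_iff of_nat_power order_trans)
    also have "real m ^ k = (2 powr s) ^ k"
      using m1 by (simp add: s_def)
    also have "\<dots> = (2 powr k) powr s"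
      by (simp only: powr_power powr_powr mult.commute)
    also have "\<dots> \<le> (2 * (R / r)) powr s"
    proof (rule powr_mono2)
      have "2 powr k \<le> 2 powr (log 2 (R / r) + 1)"
        using k1 by simp
      also have "\<dots> = 2 * (R / r)"
        using that by (simp add: powr_add)
      finally show "2 powr k \<le> 2 * (R / r)" .
    qed (use s0 in auto)
    also have "\<dots> = 2 powr s * (R / r) powr s"
      using that by (simp add: powr_mult powr_divide)
    finally show ?thesis .
  qed
  show thesis
    by (rule that[of "2 powr s" s]) (use s0 main in auto)
qed

section \<open>Assouad and box dimensions\<close>

text \<open>With s < 0 the bound would tend to 0 as r does, although a non-empty set always needs
  one ball. This bounds the sets of exponents from below, so that the real infima behave.\<close>

lemma exponent_nonneg:
  fixes N :: "real \<Rightarrow> nat"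
  assumes "R > 0" and N: "\<And>r. 0 < r \<Longrightarrow> r \<le> R \<Longrightarrow> 1 \<le> N r \<and> real (N r) \<le> C * (R / r) powr s"
  shows "0 \<le> s"
proof (rule ccontr)
  assume "\<not> 0 \<le> s"
  then have "((\<lambda>t. C * t powr s) \<longlongrightarrow> C * 0) at_top"
    by (intro tendsto_intros tendsto_neg_powr filterlim_ident) auto
  then have "eventually (\<lambda>t. C * t powr s < 1) at_top"
    by (intro order_tendstoD(2)[of _ 0]) auto
  then obtain T where T: "\<And>t. t \<ge> T \<Longrightarrow> C * t powr s < 1"
    unfolding eventually_at_top_linorder by auto
  define t where "t = max T 1"
  have t1: "1 \<le> t"
    by (simp add: t_def)
  have "0 < R / t" "R / t \<le> R"
    using assms(1) t1 by (auto simp: pos_divide_le_eq)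
  then have "1 \<le> C * (R / (R / t)) powr s"
    using N[of "R / t"] by linarith
  then have "1 \<le> C * t powr s"
    using assms(1) by simp
  then show False
    using T[of t] by (simp add: t_def)
qed

definition assouad_exponent :: "'a::metric_space set \<Rightarrow> real \<Rightarrow> bool" where
  "assouad_exponent K s \<longleftrightarrow> (\<exists>C>0. \<forall>r R. 0 < r \<and> r \<le> R \<and> R < 1 \<longrightarrow>
            (\<forall>x\<in>K. real (covering_num r (cball x R \<inter> K)) \<le> C * (R / r) powr s))"

definition pointwise_assouad_exponent :: "'a::metric_space set \<Rightarrow> 'a \<Rightarrow> real \<Rightarrow> bool" where
  "pointwise_assouad_exponent K x s \<longleftrightarrow> (\<exists>C>0. \<exists>\<rho>>0. \<forall>r R. 0 < r \<and> r \<le> R \<and> R < \<rho> \<longrightarrow>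
            real (covering_num r (cball x R \<inter> K)) \<le> C * (R / r) powr s)"

lemma assouad_dim_eq: "assouad_dim K = Inf (Collect (assouad_exponent K))"
  unfolding assouad_dim_def assouad_exponent_def by (rule refl)

lemma pointwise_assouad_dim_eq:
  "pointwise_assouad_dim K x = Inf (Collect (pointwise_assouad_exponent K x))"
  unfolding pointwise_assouad_dim_def pointwise_assouad_exponent_def by (rule refl)

lemma pointwise_assouad_exponent_nonneg:
  fixes K :: "'a::heine_borel set"
  assumes "x \<in> K" "pointwise_assouad_exponent K x s"
  shows "0 \<le> s"
proof -
  obtain C \<rho> where *: "C > 0" "\<rho> > 0"
    "\<And>r R. 0 < r \<Longrightarrow> r \<le> R \<Longrightarrow> R < \<rho> \<Longrightarrow> real (covering_num r (cball x R \<inter> K)) \<le> C * (R / r) powr s"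
    using assms unfolding pointwise_assouad_exponent_def by blast
  show ?thesis
  proof (rule exponent_nonneg)
    show "\<rho> / 2 > 0"
      using * by simp
    fix r assume r: "0 < r" "r \<le> \<rho> / 2"
    have "1 \<le> covering_num r (cball x (\<rho> / 2) \<inter> K)"
    proof (intro covering_num_pos bounded_Int disjI1 bounded_cball)
      have "x \<in> cball x (\<rho> / 2) \<inter> K"
        using assms * by simp
      then show "cball x (\<rho> / 2) \<inter> K \<noteq> {}"
        by blast
    qed (use r in auto)
    then show "1 \<le> covering_num r (cball x (\<rho> / 2) \<inter> K) \<and>
        real (covering_num r (cball x (\<rho> / 2) \<inter> K)) \<le> C * (\<rho> / 2 / r) powr s"
      using *(3)[of r "\<rho> / 2"] r * by simp
  qed
qed

lemma assouad_exponent_pointwise: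
  assumes "assouad_exponent K s" "x \<in> K"
  shows "pointwise_assouad_exponent K x s"
proof -
  obtain C where "C > 0" "\<forall>r R. 0 < r \<and> r \<le> R \<and> R < 1 \<longrightarrow>
            (\<forall>x\<in>K. real (covering_num r (cball x R \<inter> K)) \<le> C * (R / r) powr s)"
    using assms(1) unfolding assouad_exponent_def by blast
  then show ?thesis
    unfolding pointwise_assouad_exponent_def using assms(2)
    by (intro exI[of _ C] exI[of _ 1] conjI) simp_all
qed

lemma assouad_exponent_exists:
  fixes K :: "'a::euclidean_space set"
  obtains s where "assouad_exponent K s"
proof (rule covering_num_cball_doubling)
  fix C s :: real
  assume "C > 0"
    "\<And>(x::'a) r R E. 0 < r \<Longrightarrow> r \<le> R \<Longrightarrow> real (covering_num r (cball x R \<inter> E)) \<le> C * (R / r) powr s"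
  then have "assouad_exponent K s"
    unfolding assouad_exponent_def by (intro exI[of _ C]) simp
  then show thesis
    by (rule that)
qed

lemma assouad_dim_le:
  fixes K :: "'a::heine_borel set"
  assumes "K \<noteq> {}" "assouad_exponent K s"
  shows "assouad_dim K \<le> s"
proof -
  have "bdd_below (Collect (assouad_exponent K))"
  proof (rule bdd_belowI)
    fix t assume "t \<in> Collect (assouad_exponent K)"
    then show "0 \<le> t"
      using assms(1) pointwise_assouad_exponent_nonneg assouad_exponent_pointwise
      by (metis ex_in_conv mem_Collect_eq)
  qed
  then show ?thesis
    using assms(2) unfolding assouad_dim_eq
    by (intro cInf_lower) auto
qed

lemma assouad_dim_less:
  fixes K :: "'a::euclidean_space set"
  assumes "assouad_dim K < t"
  obtains s where "assouad_exponent K s" "s < t"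
proof -
  have "Collect (assouad_exponent K) \<noteq> {}"
    using assouad_exponent_exists[of K] by (metis empty_iff mem_Collect_eq)
  then have "\<exists>s\<in>Collect (assouad_exponent K). s < t"
    using assms unfolding assouad_dim_eq by (intro cInf_lessD) auto
  then show thesis
    using that by auto
qed

lemma pointwise_assouad_dim_le:
  fixes K :: "'a::heine_borel set"
  assumes "x \<in> K" "pointwise_assouad_exponent K x s"
  shows "pointwise_assouad_dim K x \<le> s"
proof -
  have "bdd_below (Collect (pointwise_assouad_exponent K x))"
    using pointwise_assouad_exponent_nonneg[OF assms(1)] by (intro bdd_belowI) simp
  then show ?thesis
    using assms(2) unfolding pointwise_assouad_dim_eq
    by (intro cInf_lower) auto
qed

lemma pointwise_assouad_dim_less:
  fixes K :: "'a::euclidean_space set"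
  assumes "x \<in> K" "pointwise_assouad_dim K x < t"
  obtains s where "pointwise_assouad_exponent K x s" "s < t"
proof -
  have "Collect (pointwise_assouad_exponent K x) \<noteq> {}"
    using assouad_exponent_exists[of K] assouad_exponent_pointwise[OF _ assms(1)]
    by (metis empty_iff mem_Collect_eq)
  then have "\<exists>s\<in>Collect (pointwise_assouad_exponent K x). s < t"
    using assms unfolding pointwise_assouad_dim_eq
    by (intro cInf_lessD) auto
  then show thesis
    using that by auto
qed

lemma pointwise_assouad_dim_le_assouad_dim:
  fixes K :: "'a::euclidean_space set"
  assumes "x \<in> K"
  shows "pointwise_assouad_dim K x \<le> assouad_dim K"
proof (rule ccontr)
  assume "\<not> ?thesis"
  then obtain s where "assouad_exponent K s" "s < pointwise_assouad_dim K x"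
    using assouad_dim_less[of K "pointwise_assouad_dim K x"] by auto
  then show False
    using pointwise_assouad_dim_le[OF assms assouad_exponent_pointwise[OF _ assms]] by fastforce
qed

lemma assouad_dim_nonneg:
  fixes K :: "'a::euclidean_space set"
  assumes "K \<noteq> {}"
  shows "0 \<le> assouad_dim K"
proof -
  obtain x where x: "x \<in> K"
    using assms by blast
  have "Collect (assouad_exponent K) \<noteq> {}"
    using assouad_exponent_exists[of K] by (metis empty_iff mem_Collect_eq)
  then show ?thesis
    unfolding assouad_dim_eq
    using pointwise_assouad_exponent_nonneg[OF x] assouad_exponent_pointwise[OF _ x]
    by (intro cInf_greatest) auto
qed

text \<open>By compactness a large ball is covered by a fixed number of balls of radius \<rho>/2, so
  the range of radii in the Assouad dimension may be cut down to any neighbourhood of 0.\<close>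

lemma assouad_exponent_local:
  fixes K :: "'a::heine_borel set"
  assumes "compact K" "0 \<le> s" "0 < \<rho>" "0 < C"
    and N: "\<And>x r R. x \<in> K \<Longrightarrow> 0 < r \<Longrightarrow> r \<le> R \<Longrightarrow> R < \<rho> \<Longrightarrow>
      real (covering_num r (cball x R \<inter> K)) \<le> C * (R / r) powr s"
  shows "assouad_exponent K s"
proof -
  have bK: "bounded K"
    using assms(1) compact_imp_bounded by blast
  define R0 where "R0 = \<rho> / 2"
  have R0: "R0 > 0" "R0 < \<rho>"
    using assms R0_def by auto
  obtain k where k: "finite k" "k \<subseteq> K" "K \<subseteq> (\<Union>x\<in>k. ball x R0)"
  proof (rule compactE_image[OF assms(1), of K "\<lambda>x. ball x R0"])
    show "K \<subseteq> (\<Union>x\<in>K. ball x R0)"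
      using R0 by auto
  qed auto
  \<comment> \<open>The \<open>+ 1\<close> keeps \<open>D \<ge> C\<close> even if \<open>k\<close>
    is empty.\<close>
  define D where "D = (real (card k) + 1) * max C 1"
  have D: "D > 0" "D \<ge> C"
  proof -
    have "1 * max C 1 \<le> D"
      unfolding D_def by (intro mult_right_mono) auto
    then show "D > 0" "D \<ge> C"
      by auto
  qed
  have "real (covering_num r (cball x R \<inter> K)) \<le> D * (R / r) powr s"
    if "0 < r" "r \<le> R" "x \<in> K" for r R x
  proof (cases "R < \<rho>")
    case True
    have "real (covering_num r (cball x R \<inter> K)) \<le> C * (R / r) powr s"
      using N that True by blast
    also have "\<dots> \<le> D * (R / r) powr s"
      using D by (intro mult_right_mono) auto
    finally show ?thesis .
  next
    case False
    have 1: "1 \<le> (R / r) powr s"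
      using that assms by (intro ge_one_powr_ge_zero) auto
    have *: "real (covering_num r (cball y R0 \<inter> K)) \<le> max C 1 * (R / r) powr s" if "y \<in> K" for y
    proof (cases "r \<le> R0")
      case True
      have "real (covering_num r (cball y R0 \<inter> K)) \<le> C * (R0 / r) powr s"
        using N that True R0 \<open>0 < r\<close> by blast
      also have "\<dots> \<le> max C 1 * (R / r) powr s"
        using R0 False \<open>0 < r\<close> assms by (intro mult_mono powr_mono2 divide_right_mono) auto
      finally show ?thesis .
    next
      case False
      then have "covering_num r (cball y R0 \<inter> K) \<le> 1"
        by (intro covering_num_small[of _ y]) auto
      moreover have "1 * 1 \<le> max C 1 * (R / r) powr s"
        using 1 by (intro mult_mono) auto
      ultimately show ?thesis
        by linarith
    qed
    have "covering_num r (cball x R \<inter> K) \<le> (\<Sum>y\<in>k. covering_num r (cball y R0 \<inter> K))"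
      using k that by (intro covering_num_UN bounded_Int disjI1 bounded_cball) force+
    then have "real (covering_num r (cball x R \<inter> K)) \<le> (\<Sum>y\<in>k. real (covering_num r (cball y R0 \<inter> K)))"
      by (metis of_nat_le_iff of_nat_sum)
    also have "\<dots> \<le> (\<Sum>y\<in>k. max C 1 * (R / r) powr s)"
      using k by (intro sum_mono *) auto
    also have "\<dots> = real (card k) * max C 1 * (R / r) powr s"
      by simp
    also have "\<dots> \<le> D * (R / r) powr s"
      unfolding D_def by (intro mult_right_mono) auto
    finally show ?thesis .
  qed
  then show ?thesis
    unfolding assouad_exponent_def using D by blast
qed

section \<open>Upper box dimension and packing dimension\<close>

lemma upper_box_dim_le:
  fixes E :: "'a::heine_borel set"
  assumes E: "E \<noteq> {}" "bounded E" and "C > 0"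
    and ev: "eventually (\<lambda>r. real (covering_num r E) \<le> C * (1 / r) powr s) (at_right 0)"
  shows "upper_box_dim E \<le> ereal s"
proof -
  have "eventually (\<lambda>r::real. r \<in> {0<..<1}) (at_right 0)"
    by (rule eventually_at_right_real) simp
  with ev have "eventually (\<lambda>r. ereal (ln (real (covering_num r E)) / ln (1 / r))
      \<le> ereal (s + ln C / ln (1 / r))) (at_right 0)"
  proof eventually_elim
    case (elim r)
    then have r: "0 < r" "r < 1"
      by auto
    have "1 \<le> covering_num r E"
      using covering_num_pos E r by blast
    then have "ln (real (covering_num r E)) \<le> ln (C * (1 / r) powr s)"
      using elim by simp
    also have "\<dots> = ln C + s * ln (1 / r)"
      using r \<open>C > 0\<close> by (simp add: ln_mult)
    finally have "ln (real (covering_num r E)) / ln (1 / r) \<le> (ln C + s * ln (1 / r)) / ln (1 / r)"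
      using r by (intro divide_right_mono) auto
    also have "\<dots> = s + ln C / ln (1 / r)"
      using r by (simp add: add_divide_distrib)
    finally show ?case
      by simp
  qed
  then have "upper_box_dim E \<le> Limsup (at_right 0) (\<lambda>r. ereal (s + ln C / ln (1 / r)))"
    unfolding upper_box_dim_def by (rule Limsup_mono)
  also have "\<dots> = ereal s"
  proof (rule lim_imp_Limsup)
    \<comment> \<open>The constant \<open>C\<close> enters only through a term that vanishes as r
      tends to 0.\<close>
    have "((\<lambda>r. s + ln C / ln (1 / r)) \<longlongrightarrow> s) (at_right 0)"
      by real_asymp
    then show "((\<lambda>r. ereal (s + ln C / ln (1 / r))) \<longlongrightarrow> ereal s) (at_right 0)"
      by simp
  qed simp
  finally show ?thesis .
qed

lemma upper_box_dim_less:
  fixes E :: "'a::heine_borel set"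
  assumes "upper_box_dim E < ereal s"
  shows "eventually (\<lambda>r. real (covering_num r E) \<le> (1 / r) powr s) (at_right 0)"
proof -
  have "eventually (\<lambda>r::real. r \<in> {0<..<1}) (at_right 0)"
    by (rule eventually_at_right_real) simp
  with Limsup_lessD[OF assms[unfolded upper_box_dim_def]] show ?thesis
  proof eventually_elim
    case (elim r)
    then have r: "0 < r" "r < 1" and *: "ln (real (covering_num r E)) / ln (1 / r) < s"
      by auto
    have l: "ln (1 / r) > 0"
      using r by simp
    show ?case
    proof (cases "covering_num r E = 0")
      case False
      have "ln (real (covering_num r E)) < s * ln (1 / r)"
        using * l by (simp add: pos_divide_less_eq)
      also have "\<dots> = ln ((1 / r) powr s)"
        using r by (simp add: ln_div)
      finally show ?thesis
        using False r by (subst (asm) ln_less_cancel_iff) auto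
    qed simp
  qed
qed

text \<open>The radius r for \<open>A\<close> is compared with c r / 2 for \<open>B\<close>; the
  resulting constant factor is invisible to the box dimension.\<close>

lemma upper_box_dim_embedding:
  fixes A :: "'a::heine_borel set" and B :: "'b::heine_borel set"
  assumes "A \<noteq> {}" "bounded A" "bounded B" "g ` A \<subseteq> B" "c > 0"
    and g: "\<And>x y. x \<in> A \<Longrightarrow> y \<in> A \<Longrightarrow> c * dist x y \<le> dist (g x) (g y)"
  shows "upper_box_dim A \<le> upper_box_dim B"
proof (rule ereal_le_real)
  fix t assume "upper_box_dim B \<le> ereal t"
  have "upper_box_dim A \<le> ereal s" if "t < s" for s
  proof -
    have "upper_box_dim B < ereal s"
      using \<open>upper_box_dim B \<le> ereal t\<close> that by (simp add: order_le_less_trans)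
    then have "eventually (\<lambda>r. real (covering_num r B) \<le> (1 / r) powr s) (at_right 0)"
      by (rule upper_box_dim_less)
    moreover have "filterlim (\<lambda>r. c / 2 * r) (at_right 0) (at_right 0)"
      using assms(5) by real_asymp
    ultimately have "eventually (\<lambda>r. real (covering_num (c / 2 * r) B) \<le> (1 / (c / 2 * r)) powr s) (at_right 0)"
      by (rule eventually_compose_filterlim)
    moreover have "eventually (\<lambda>r::real. r \<in> {0<..<1}) (at_right 0)"
      by (rule eventually_at_right_real) simp
    ultimately have "eventually (\<lambda>r. real (covering_num r A) \<le> (2 / c) powr s * (1 / r) powr s) (at_right 0)"
    proof eventually_elim
      case (elim r)
      have "covering_num r A \<le> covering_num (c / 2 * r) B"
        using assms elim by (intro covering_num_embedding[of g]) auto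
      also have "real \<dots> \<le> (1 / (c / 2 * r)) powr s"
        using elim by simp
      also have "1 / (c / 2 * r) = (2 / c) * (1 / r)"
        using elim by simp
      also have "\<dots> powr s = (2 / c) powr s * (1 / r) powr s"
        using elim assms by (subst powr_mult) auto
      finally show ?case
        by simp
    qed
    then show ?thesis
      using assms by (intro upper_box_dim_le[of _ "(2 / c) powr s"]) auto
  qed
  note le = this
  show "upper_box_dim A \<le> ereal t"
  proof (rule dense_ge)
    fix y assume "ereal t < y"
    then obtain s where "ereal t < ereal s" "ereal s < y"
      using ereal_dense2 by blast
    then show "upper_box_dim A \<le> y"
      using le[of s] by (simp add: order_trans[OF _ less_imp_le])
  qed
qed

text \<open>Finite unions of closed balls are closed, so they cover a set exactly when they cover
  its closure. This links box dimension to Baire category: a set dense in a piece of K has at least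
  the box dimension of that piece.\<close>

lemma upper_box_dim_closure:
  fixes E :: "'a::heine_borel set"
  shows "upper_box_dim (closure E) = upper_box_dim E"
proof -
  have "E \<subseteq> (\<Union>c\<in>C. cball c r) \<longleftrightarrow> closure E \<subseteq> (\<Union>c\<in>C. cball c r)" if "finite C" for C r
    using closure_subset[of E] closure_minimal[of E "\<Union>c\<in>C. cball c r"] closed_UN[OF that, of "\<lambda>c. cball c r"]
    by auto
  then have "covering_num r (closure E) = covering_num r E" for r
    unfolding covering_num_def by metis
  then show ?thesis
    unfolding upper_box_dim_def by simp
qed

lemma packing_dim_mono:
  assumes "A \<subseteq> B"
  shows "packing_dim A \<le> packing_dim B"
  unfolding packing_dim_def using assms by (intro INF_superset_mono) auto

lemma packing_dim_le_upper_box_dim: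
  assumes "bounded E"
  shows "packing_dim E \<le> upper_box_dim E"
  unfolding packing_dim_def using assms by (intro INF_lower2[of "\<lambda>_. E"]) auto

section \<open>Lower bounds for Hausdorff measures\<close>

text \<open>Reduction to finite open covers: the i-th set is fattened to an open one at a cost of at
  most \<kappa> / 2^(i+1), and compactness leaves finitely many. Positive bounds \<open>d i\<close>
  in place of diameters remove the special cases of \<open>diam_pow\<close> at s = 0 and at diameter
  0.\<close>

lemma hausdorff_measure_ge:
  fixes F :: "'a::metric_space set"
  assumes "compact F" "0 \<le> s" "0 < \<delta>"
    and cov: "\<And>(I::nat set) V d. finite I \<Longrightarrow>
      (\<And>i. i \<in> I \<Longrightarrow> open (V i) \<and> 0 < d i \<and> d i \<le> \<delta> \<and> (\<forall>x\<in>V i. \<forall>y\<in>V i. dist x y \<le> d i)) \<Longrightarrow>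
      F \<subseteq> (\<Union>i\<in>I. V i) \<Longrightarrow> \<beta> \<le> (\<Sum>i\<in>I. d i powr s)"
  shows "ennreal \<beta> \<le> hausdorff_measure s F"
proof -
  have "ennreal \<beta> \<le> (\<Sum>i. ennreal (diam_pow s (U i)))"
    if U: "\<And>i. bounded (U i)" "\<And>i. diameter (U i) \<le> \<delta> / 2" "F \<subseteq> (\<Union>i. U i)"
    for U :: "nat \<Rightarrow> 'a set"
  proof (rule ennreal_le_epsilon)
    fix \<kappa> :: real assume "\<kappa> > 0"
    have "\<exists>d > diameter (U i). d \<le> \<delta> \<and> d powr s \<le> diam_pow s (U i) + \<kappa> * (1/2) ^ Suc i"
      if "U i \<noteq> {}" for i
    proof (cases "s = 0")
      \<comment> \<open>Here \<open>diam_pow\<close> is 1, as is every positive number to the power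
        0, so the largest permitted \<open>d\<close> serves.\<close>
      case True
      then show ?thesis
        using U(2)[of i] \<open>\<delta> > 0\<close> \<open>\<kappa> > 0\<close> that
        by (intro exI[of _ \<delta>]) (auto simp: diam_pow_def)
    next
      case False
      let ?D = "diameter (U i)"
      have "((\<lambda>d. d powr s) \<longlongrightarrow> ?D powr s) (at_right ?D)"
      proof (rule tendsto_powr')
        show "?D \<noteq> 0 \<or> 0 < s \<and> (\<forall>\<^sub>F x in at_right ?D. 0 \<le> x)"
          using False assms(2) diameter_ge_0[OF U(1)[of i]]
          by (auto simp: eventually_at_right_less intro: eventually_mono[OF eventually_at_right_less])
      qed (auto intro: tendsto_eq_intros)
      then have "eventually (\<lambda>d. d powr s < ?D powr s + \<kappa> * (1/2) ^ Suc i) (at_right ?D)"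
        using \<open>\<kappa> > 0\<close> by (intro order_tendstoD(2)) auto
      moreover have "eventually (\<lambda>d. d \<in> {?D<..<\<delta>}) (at_right ?D)"
        using U(2)[of i] \<open>\<delta> > 0\<close> by (intro eventually_at_right_real) linarith
      ultimately have "eventually (\<lambda>d. d > ?D \<and> d \<le> \<delta> \<and> d powr s \<le> ?D powr s + \<kappa> * (1/2) ^ Suc i) (at_right ?D)"
        by eventually_elim auto
      then show ?thesis
        using False that eventually_happens'[OF trivial_limit_at_right_real]
        by (auto simp: diam_pow_def)
    qed
    then obtain d where d: "\<And>i. U i \<noteq> {} \<Longrightarrow> diameter (U i) < d i \<and> d i \<le> \<delta> \<and>
        d i powr s \<le> diam_pow s (U i) + \<kappa> * (1/2) ^ Suc i"
      by metis
    \<comment> \<open>Each of two points may move by half the slack between \<open>d i\<close> and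
      the diameter, so distances stay below \<open>d i\<close>.\<close>
    define V where "V i = (\<Union>u\<in>U i. ball u ((d i - diameter (U i)) / 2))" for i
    have UV: "U i \<subseteq> V i" for i
      using d[of i] unfolding V_def by force
    have cover: "F \<subseteq> (\<Union>i\<in>UNIV. V i)"
    proof
      fix x assume "x \<in> F"
      then obtain i where "x \<in> U i"
        using U(3) by auto
      then show "x \<in> (\<Union>i\<in>UNIV. V i)"
        using UV[of i] by auto
    qed
    obtain J where J: "finite J" "F \<subseteq> (\<Union>i\<in>J. V i)"
    proof (rule compactE_image[OF assms(1) _ cover])
      show "open (V i)" for i
        by (auto simp: V_def)
    qed auto
    \<comment> \<open>Indices with \<open>U i = {}\<close> are dropped because \<open>d i\<close> is
      unspecified there.\<close>
    define I where "I = {i\<in>J. U i \<noteq> {}}"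
    have I: "finite I" "\<And>i. i \<in> I \<Longrightarrow> U i \<noteq> {}"
      using J I_def by auto
    have "\<beta> \<le> (\<Sum>i\<in>I. d i powr s)"
    proof (rule cov)
      show "F \<subseteq> (\<Union>i\<in>I. V i)"
      proof
        fix x assume "x \<in> F"
        then obtain i where i: "i \<in> J" "x \<in> V i"
          using J by auto
        then have "U i \<noteq> {}"
          by (auto simp: V_def)
        then show "x \<in> (\<Union>i\<in>I. V i)"
          using i by (auto simp: I_def)
      qed
      fix i assume "i \<in> I"
      then have i: "U i \<noteq> {}"
        by (rule I)
      have "dist x y \<le> d i" if xy: "x \<in> V i" "y \<in> V i" for x y
      proof -
        obtain u v where uv: "u \<in> U i" "v \<in> U i" "dist u x < (d i - diameter (U i)) / 2"
            "dist v y < (d i - diameter (U i)) / 2"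
          using xy unfolding V_def by auto
        have "dist u v \<le> diameter (U i)"
          using uv U(1) by (intro diameter_bounded_bound) auto
        then show ?thesis
          using uv dist_triangle[of x y u] dist_triangle[of u y v] by (simp add: dist_commute)
      qed
      then show "open (V i) \<and> 0 < d i \<and> d i \<le> \<delta> \<and> (\<forall>x\<in>V i. \<forall>y\<in>V i. dist x y \<le> d i)"
        using d[OF i] diameter_ge_0[OF U(1)[of i]] by (auto simp: V_def)
    qed (rule I)
    also have "\<dots> \<le> (\<Sum>i\<in>I. diam_pow s (U i) + \<kappa> * (1/2) ^ Suc i)"
      using d I by (intro sum_mono) blast
    also have "\<dots> = (\<Sum>i\<in>I. diam_pow s (U i)) + \<kappa> * (\<Sum>i\<in>I. (1/2) ^ Suc i)"
      by (simp add: sum.distrib sum_distrib_left)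
    also have "\<dots> \<le> (\<Sum>i\<in>I. diam_pow s (U i)) + \<kappa> * 1"
    proof (intro add_left_mono mult_left_mono)
      show "(\<Sum>i\<in>I. (1/2) ^ Suc i) \<le> (1::real)"
        using sum_le_suminf[OF sums_summable[OF power_half_series] \<open>finite I\<close>] sums_unique[OF power_half_series]
        by simp
    qed (use \<open>\<kappa> > 0\<close> in simp)
    finally have "ennreal \<beta> \<le> ennreal ((\<Sum>i\<in>I. diam_pow s (U i)) + \<kappa>)"
      by (intro ennreal_leI) simp
    also have "\<dots> = (\<Sum>i\<in>I. ennreal (diam_pow s (U i))) + ennreal \<kappa>"
      using \<open>\<kappa> > 0\<close> by (subst ennreal_plus) (auto simp: sum_ennreal diam_pow_def intro!: sum_nonneg)
    also have "\<dots> \<le> (\<Sum>i. ennreal (diam_pow s (U i))) + ennreal \<kappa>"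
      using I by (intro add_right_mono sum_le_suminf) auto
    finally show "ennreal \<beta> \<le> (\<Sum>i. ennreal (diam_pow s (U i))) + ennreal \<kappa>" .
  qed
  then have "ennreal \<beta> \<le> hausdorff_premeasure s (\<delta> / 2) F"
    unfolding hausdorff_premeasure_def by (intro INF_greatest) auto
  also have "\<dots> \<le> hausdorff_measure s F"
    unfolding hausdorff_measure_def using assms(3) by (intro SUP_upper) auto
  finally show ?thesis .
qed

lemma hausdorff_measure_mono:
  assumes "A \<subseteq> B"
  shows "hausdorff_measure s A \<le> hausdorff_measure s B"
  unfolding hausdorff_measure_def hausdorff_premeasure_def
  using assms by (intro SUP_mono' INF_superset_mono) auto

lemma hausdorff_dim_mono:
  assumes "A \<subseteq> B"
  shows "hausdorff_dim A \<le> hausdorff_dim B"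
  unfolding hausdorff_dim_def
proof (rule INF_superset_mono)
  show "{s. 0 \<le> s \<and> hausdorff_measure s B = 0} \<subseteq> {s. 0 \<le> s \<and> hausdorff_measure s A = 0}"
    using hausdorff_measure_mono[OF assms] by (auto simp: le_zero_eq[symmetric] simp del: le_zero_eq) (metis le_zero_eq)
qed simp

text \<open>A discretised form of a lower bound \<open>R powr s\<close> for the \<open>s\<close>-dimensional Hausdorff measure: since
  scales below \<open>\<epsilon> * R\<close> are ignored, such bounds survive limits in the Hausdorff metric as \<open>\<epsilon>\<close> tends to 0.\<close>
definition thick :: "real \<Rightarrow> real \<Rightarrow> real \<Rightarrow> 'a::metric_space set \<Rightarrow> bool" where
  "thick \<epsilon> s R A \<longleftrightarrow> (\<forall>(I::nat set) U d. finite I \<longrightarrow>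
     (\<forall>i\<in>I. \<epsilon> * R \<le> d i \<and> d i \<le> R / 2 \<and> (\<forall>x\<in>U i. \<forall>y\<in>U i. dist x y \<le> d i)) \<longrightarrow>
     A \<subseteq> (\<Union>i\<in>I. U i) \<longrightarrow> R powr s \<le> (\<Sum>i\<in>I. d i powr s))"

lemma thickD:
  assumes "thick \<epsilon> s R A" "finite (I::nat set)" "A \<subseteq> (\<Union>i\<in>I. U i)"
    "\<And>i. i \<in> I \<Longrightarrow> \<epsilon> * R \<le> d i" "\<And>i. i \<in> I \<Longrightarrow> d i \<le> R / 2"
    "\<And>i x y. i \<in> I \<Longrightarrow> x \<in> U i \<Longrightarrow> y \<in> U i \<Longrightarrow> dist x y \<le> d i"
  shows "R powr s \<le> (\<Sum>i\<in>I. d i powr s)"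
  using assms(1)[unfolded thick_def, rule_format, of I d U] assms(2-) by simp

lemma thick_mono:
  assumes "thick \<epsilon> s R A" "A \<subseteq> B"
  shows "thick \<epsilon> s R B"
  unfolding thick_def
proof (intro allI impI)
  fix I :: "nat set" and U d
  assume "finite I"
    "\<forall>i\<in>I. \<epsilon> * R \<le> d i \<and> d i \<le> R / 2 \<and> (\<forall>x\<in>U i. \<forall>y\<in>U i. dist x y \<le> d i)"
    "B \<subseteq> (\<Union>i\<in>I. U i)"
  then show "R powr s \<le> (\<Sum>i\<in>I. d i powr s)"
    using assms(2) by (intro thickD[OF assms(1), of I U]) auto
qed

text \<open>Pulling a cover back along \<open>g\<close> multiplies its diameter bounds by 1/c. The
  cutoff is measured relative to the radius, hence \<open>\<epsilon>\<close> does not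
  change.\<close>

lemma thick_image:
  assumes A: "thick \<epsilon> s R A" and c: "c > 0" and R: "R > 0" "\<epsilon> > 0"
    and g: "\<And>x y. x \<in> A \<Longrightarrow> y \<in> A \<Longrightarrow> c * dist x y \<le> dist (g x) (g y)"
  shows "thick \<epsilon> s (c * R) (g ` A)"
  unfolding thick_def
proof (intro allI impI)
  fix I :: "nat set" and U d
  assume I: "finite I" and d: "\<forall>i\<in>I. \<epsilon> * (c * R) \<le> d i \<and> d i \<le> c * R / 2 \<and> (\<forall>x\<in>U i. \<forall>y\<in>U i. dist x y \<le> d i)"
    and cov: "g ` A \<subseteq> (\<Union>i\<in>I. U i)"
  have dpos: "d i > 0" if "i \<in> I" for i
    using d that c R by (smt (verit, best) mult_pos_pos)
  have "R powr s \<le> (\<Sum>i\<in>I. (d i / c) powr s)"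
  proof (rule thickD[OF A I, of "\<lambda>i. {x\<in>A. g x \<in> U i}"])
    show "A \<subseteq> (\<Union>i\<in>I. {x \<in> A. g x \<in> U i})"
      using cov by auto
    fix i assume i: "i \<in> I"
    show "\<epsilon> * R \<le> d i / c" "d i / c \<le> R / 2"
      using d i c by (auto simp: field_simps)
    fix x y assume "x \<in> {x \<in> A. g x \<in> U i}" "y \<in> {x \<in> A. g x \<in> U i}"
    then have "c * dist x y \<le> dist (g x) (g y)" "dist (g x) (g y) \<le> d i"
      using g d i by auto
    then show "dist x y \<le> d i / c"
      using c by (simp add: pos_le_divide_eq mult.commute)
  qed
  also have "\<dots> = (\<Sum>i\<in>I. d i powr s) / c powr s"
    using dpos c by (simp add: powr_divide sum_divide_distrib less_imp_le)
  finally show "(c * R) powr s \<le> (\<Sum>i\<in>I. d i powr s)"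
    using c R by (simp add: powr_mult pos_le_divide_eq mult.commute)
qed

text \<open>Powers with exponent s \<le> 0 decrease, so a single piece already contributes
  \<open>R powr s\<close>. This settles the levels at which the deficit 1/(m+1) exceeds
  \<open>assouad_dim K\<close>.\<close>

lemma thick_nonpos:
  assumes "s \<le> 0" "A \<noteq> {}" "R > 0" "\<epsilon> > 0"
  shows "thick \<epsilon> s R A"
  unfolding thick_def
proof (intro allI impI)
  fix I :: "nat set" and U d
  assume I: "finite I" and d: "\<forall>i\<in>I. \<epsilon> * R \<le> d i \<and> d i \<le> R / 2 \<and> (\<forall>x\<in>U i. \<forall>y\<in>U i. dist x y \<le> d i)"
    and cov: "A \<subseteq> (\<Union>i\<in>I. U i)"
  obtain i where i: "i \<in> I"
    using assms(2) cov by auto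
  have "0 < \<epsilon> * R" "\<epsilon> * R \<le> d i" "d i \<le> R / 2"
    using d i assms by auto
  then have "0 < d i" "d i \<le> R"
    using assms(3) by linarith+
  then have "R powr s \<le> d i powr s"
    using assms by (intro powr_mono2') auto
  also have "\<dots> \<le> (\<Sum>i\<in>I. d i powr s)"
    using i I by (intro member_le_sum) auto
  finally show "R powr s \<le> (\<Sum>i\<in>I. d i powr s)" .
qed

section \<open>Tangents\<close>

text \<open>The distance functions of the sets are 1-Lipschitz and bounded by 2 on the unit ball, so
  Arzela-Ascoli gives a uniformly convergent subsequence; \<open>F\<close> is the zero set of its
  limit. The one-sided closeness is recorded separately because it lets a cover of \<open>F\<close>
  be used as a cover of the approximating sets.\<close>

lemma blaschke_selection:
  fixes A :: "nat \<Rightarrow> 'a::euclidean_space set"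
  assumes A: "\<And>k. closed (A k)" "\<And>k. A k \<noteq> {}" "\<And>k. A k \<subseteq> cball 0 1"
  obtains F \<phi> where "F \<noteq> {}" "compact F" "F \<subseteq> cball 0 1" "strict_mono (\<phi> :: nat \<Rightarrow> nat)"
    "\<And>\<epsilon>. \<epsilon> > 0 \<Longrightarrow> \<forall>\<^sub>F k in sequentially. \<forall>a\<in>A (\<phi> k). infdist a F < \<epsilon>"
    "(\<lambda>k. hausdorff_dist (A (\<phi> k)) F) \<longlonglongrightarrow> 0"
proof -
  let ?S = "cball (0::'a) 1"
  have infdist_le2: "infdist x (A k) \<le> 2" if "x \<in> ?S" for x k
  proof -
    obtain a where a: "a \<in> A k"
      using A(2) by blast
    then have "infdist x (A k) \<le> dist x a"
      by (rule infdist_le)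
    also have "\<dots> \<le> norm x + norm a"
      by (simp add: dist_norm norm_triangle_ineq4)
    also have "\<dots> \<le> 2"
      using that a A(3)[of k] by (auto simp: subset_iff)
    finally show ?thesis .
  qed
  obtain g \<phi> where g: "continuous_on ?S g" "strict_mono (\<phi> :: nat \<Rightarrow> nat)"
      "\<And>e. 0 < e \<Longrightarrow> \<exists>N. \<forall>n x. n \<ge> N \<and> x \<in> ?S \<longrightarrow> norm (infdist x (A (\<phi> n)) - g x) < e"
  proof (rule Arzela_Ascoli[of ?S "\<lambda>k x. infdist x (A k)" 2])
    show "norm (infdist x (A n)) \<le> 2" if "x \<in> ?S" for n x
      using infdist_le2[OF that, of n] by (simp add: infdist_nonneg)
    show "\<exists>d>0. \<forall>n y. y \<in> ?S \<and> norm (x - y) < d \<longrightarrow> norm (infdist x (A n) - infdist y (A n)) < e"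
      if "0 < e" for x :: 'a and e :: real
    proof (intro exI[of _ e] conjI allI impI)
      fix n y assume "y \<in> ?S \<and> norm (x - y) < e"
      then show "norm (infdist x (A n) - infdist y (A n)) < e"
        using infdist_triangle_abs[of x "A n" y] by (simp add: dist_norm)
    qed (rule that)
  qed auto
  define F where "F = {x\<in>?S. g x = 0}"
  have lim: "(\<lambda>n. infdist x (A (\<phi> n))) \<longlonglongrightarrow> g x" if "x \<in> ?S" for x
    using g(3) that by (intro LIMSEQ_I) blast
  have "closed F"
  proof -
    have "F = ?S \<inter> g -` {0}"
      by (auto simp: F_def)
    then show ?thesis
      using continuous_closed_preimage[OF g(1) closed_cball, of "{0}"] by simp
  qed
  then have "compact F"
    by (metis (no_types, lifting) F_def compact_Int_closed compact_cball inf.absorb_iff2 mem_Collect_eq subsetI)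
  \<comment> \<open>Nearest points of the sets accumulate at a zero of the limit function, so
    \<open>g x\<close> is realised as a distance from \<open>x\<close> to a point of
    \<open>F\<close>. Hence uniform convergence of distance functions becomes closeness to
    \<open>F\<close>.\<close>
  have near: "\<exists>p\<in>F. dist x p = g x" if x: "x \<in> ?S" for x
  proof -
    have "\<exists>p\<in>A k. infdist x (A k) = dist x p" for k
      using infdist_attains_inf[OF A(1)[of k] A(2)[of k], of x] by metis
    then obtain p where p: "\<And>k. p k \<in> A k" "\<And>k. infdist x (A k) = dist x (p k)"
      by metis
    have "\<forall>n. p (\<phi> n) \<in> ?S"
      using p(1) A(3) by blast
    then obtain q r where q: "q \<in> ?S" "strict_mono (r :: nat \<Rightarrow> nat)" "((\<lambda>n. p (\<phi> n)) \<circ> r) \<longlonglongrightarrow> q"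
      using compact_cball[of "0::'a" 1] unfolding compact_def by meson
    have q': "(\<lambda>n. p (\<phi> (r n))) \<longlonglongrightarrow> q"
      using q(3) by (simp add: o_def)
    have "(\<lambda>n. dist x (p (\<phi> (r n)))) \<longlonglongrightarrow> dist x q"
      by (intro tendsto_intros q')
    moreover have "(\<lambda>n. infdist x (A (\<phi> (r n)))) \<longlonglongrightarrow> g x"
      using LIMSEQ_subseq_LIMSEQ[OF lim[OF x] q(2)] by (simp add: o_def)
    ultimately have "dist x q = g x"
      using p(2) LIMSEQ_unique by simp
    moreover have "g q = 0"
    proof -
      have "(\<lambda>n. infdist q (A (\<phi> (r n)))) \<longlonglongrightarrow> g q"
        using LIMSEQ_subseq_LIMSEQ[OF lim[OF q(1)] q(2)] by (simp add: o_def)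
      moreover have "(\<lambda>n. infdist q (A (\<phi> (r n)))) \<longlonglongrightarrow> 0"
      proof (rule tendsto_sandwich[of "\<lambda>_. 0" _ _ "\<lambda>n. dist q (p (\<phi> (r n)))"])
        show "(\<lambda>n. dist q (p (\<phi> (r n)))) \<longlonglongrightarrow> 0"
          using tendsto_dist[OF tendsto_const[of q] q'] by simp
      qed (auto intro!: always_eventually infdist_nonneg infdist_le p)
      ultimately show ?thesis
        using LIMSEQ_unique by blast
    qed
    ultimately show ?thesis
      using q(1) by (auto simp: F_def)
  qed
  have Fne: "F \<noteq> {}"
    using near[of 0] by auto
  have close1: "\<forall>\<^sub>F k in sequentially. \<forall>a\<in>A (\<phi> k). infdist a F < \<epsilon>"
    and close2: "\<forall>\<^sub>F k in sequentially. \<forall>b\<in>F. infdist b (A (\<phi> k)) < \<epsilon>" if "\<epsilon> > 0" for \<epsilon>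
  proof -
    obtain N where N: "\<And>n x. n \<ge> N \<Longrightarrow> x \<in> ?S \<Longrightarrow> norm (infdist x (A (\<phi> n)) - g x) < \<epsilon>"
      using g(3)[OF \<open>\<epsilon> > 0\<close>] by blast
    have "infdist a F < \<epsilon>" if "k \<ge> N" "a \<in> A (\<phi> k)" for k a
    proof -
      have "a \<in> ?S"
        using A(3) that by blast
      then obtain p where "p \<in> F" "dist a p = g a"
        using near by blast
      then have "infdist a F \<le> g a"
        using infdist_le by metis
      then show ?thesis
        using N[OF that(1) \<open>a \<in> ?S\<close>] that(2) by simp
    qed
    then show "\<forall>\<^sub>F k in sequentially. \<forall>a\<in>A (\<phi> k). infdist a F < \<epsilon>"
      unfolding eventually_sequentially by blast
    have "infdist b (A (\<phi> k)) < \<epsilon>" if "k \<ge> N" "b \<in> F" for k b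
      using N[OF that(1), of b] that(2) by (auto simp: F_def)
    then show "\<forall>\<^sub>F k in sequentially. \<forall>b\<in>F. infdist b (A (\<phi> k)) < \<epsilon>"
      unfolding eventually_sequentially by blast
  qed
  have "(\<lambda>k. hausdorff_dist (A (\<phi> k)) F) \<longlonglongrightarrow> 0"
  proof (rule tendstoI)
    fix e :: real assume "e > 0"
    then have "e / 2 > 0"
      by simp
    from close1[OF this] close2[OF this]
    show "\<forall>\<^sub>F k in sequentially. dist (hausdorff_dist (A (\<phi> k)) F) 0 < e"
    proof eventually_elim
      case (elim k)
      have 1: "(SUP a\<in>A (\<phi> k). infdist a F) \<le> e / 2"
        using elim A(2) by (intro cSUP_least) (auto intro: less_imp_le)
      have 2: "(SUP b\<in>F. infdist b (A (\<phi> k))) \<le> e / 2"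
        using elim Fne by (intro cSUP_least) (auto intro: less_imp_le)
      obtain b where b: "b \<in> F"
        using Fne by blast
      have "0 \<le> infdist b (A (\<phi> k))"
        by (rule infdist_nonneg)
      also have "\<dots> \<le> (SUP b\<in>F. infdist b (A (\<phi> k)))"
        using elim b by (intro cSUP_upper bdd_aboveI2[of _ _ "e / 2"]) (auto intro: less_imp_le)
      finally show ?case
        using 1 2 \<open>e > 0\<close> by (simp add: hausdorff_dist_def abs_if)
    qed
  qed
  moreover have "F \<subseteq> ?S"
    by (auto simp: F_def)
  ultimately show thesis
    using that[OF Fne \<open>compact F\<close> _ g(2) close1] by blast
qed

text \<open>A finite open cover of the limit set also covers late members of the sequence, and its
  finitely many positive diameter bounds eventually exceed the cutoff b/(m+1). Thickness then
  applies, and its inequality passes to the limit in the exponent.\<close>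

lemma tangent_of_thick:
  fixes K :: "'a::euclidean_space set"
  assumes "compact K" "x \<in> K" "0 \<le> \<alpha>" "0 < b"
    and l: "\<And>m. 0 < l m" "filterlim l at_top sequentially"
    and thick: "\<And>m. thick (1 / real (Suc m)) (\<alpha> - 1 / real (Suc m)) b ((\<lambda>y. l m *\<^sub>R (y - x)) ` K \<inter> cball 0 1)"
  shows "\<exists>F\<in>Tan K x. ennreal (b powr \<alpha>) \<le> hausdorff_measure \<alpha> F"
proof -
  define A where "A m = (\<lambda>y. l m *\<^sub>R (y - x)) ` K \<inter> cball 0 1" for m
  have "closed (A m)" for m
    unfolding A_def using assms(1)
    by (intro closed_Int compact_imp_closed compact_continuous_image continuous_intros) auto
  moreover have "A m \<noteq> {}" for m
  proof -
    have "0 \<in> A m"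
      unfolding A_def using assms(2) by (auto intro!: image_eqI[of _ _ x])
    then show ?thesis
      by blast
  qed
  moreover have "A m \<subseteq> cball 0 1" for m
    by (auto simp: A_def)
  ultimately obtain F \<phi> where F: "F \<noteq> {}" "compact F" "F \<subseteq> cball 0 1" "strict_mono (\<phi> :: nat \<Rightarrow> nat)"
    "\<And>\<epsilon>. \<epsilon> > 0 \<Longrightarrow> \<forall>\<^sub>F k in sequentially. \<forall>a\<in>A (\<phi> k). infdist a F < \<epsilon>"
    "(\<lambda>k. hausdorff_dist (A (\<phi> k)) F) \<longlonglongrightarrow> 0"
    using blaschke_selection[of A] by blast
  have \<phi>: "filterlim \<phi> sequentially sequentially"
    using F(4) by (rule filterlim_subseq)
  have "F \<in> Tan K x"
    unfolding Tan_def using F l(1) filterlim_compose[OF l(2) \<phi>]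
    by (auto simp: A_def intro!: exI[of _ "\<lambda>k. l (\<phi> k)"])
  moreover have "ennreal (b powr \<alpha>) \<le> hausdorff_measure \<alpha> F"
  proof (rule hausdorff_measure_ge[OF F(2) assms(3)])
    show "b / 2 > 0"
      using assms by simp
    fix I :: "nat set" and V d
    assume I: "finite I" and V: "\<And>i. i \<in> I \<Longrightarrow> open (V i) \<and> 0 < d i \<and> d i \<le> b / 2 \<and> (\<forall>x\<in>V i. \<forall>y\<in>V i. dist x y \<le> d i)"
      and cov: "F \<subseteq> (\<Union>i\<in>I. V i)"
    have "open (\<Union>i\<in>I. V i)"
      using V by auto
    \<comment> \<open>A whole e-neighbourhood of the compact set \<open>F\<close> lies in the union,
      so every set that is e-close to \<open>F\<close> is covered.\<close>
    then obtain e where e: "e > 0" "(\<Union>p\<in>F. ball p e) \<subseteq> (\<Union>i\<in>I. V i)"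
      using compact_subset_open_imp_ball_epsilon_subset[OF F(2) _ cov] by blast
    have inv: "(\<lambda>k. 1 / real (Suc (\<phi> k))) \<longlonglongrightarrow> 0"
      using filterlim_compose[OF LIMSEQ_inverse_real_of_nat \<phi>] by (simp add: inverse_eq_divide)
    have "\<forall>\<^sub>F k in sequentially. 1 / real (Suc (\<phi> k)) * b \<le> d i" if "i \<in> I" for i
    proof -
      have "\<forall>\<^sub>F k in sequentially. 1 / real (Suc (\<phi> k)) * b < d i"
        using V[OF that] tendsto_mult_left_zero[OF inv, of b] by (intro order_tendstoD(2)) auto
      then show ?thesis
        by eventually_elim auto
    qed
    then have "\<forall>\<^sub>F k in sequentially. \<forall>i\<in>I. 1 / real (Suc (\<phi> k)) * b \<le> d i"
      using I by (simp add: eventually_ball_finite)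
    with F(5)[OF e(1)]
    have ev: "\<forall>\<^sub>F k in sequentially. b powr (\<alpha> - 1 / real (Suc (\<phi> k))) \<le> (\<Sum>i\<in>I. d i powr (\<alpha> - 1 / real (Suc (\<phi> k))))"
    proof eventually_elim
      case (elim k)
      have "A (\<phi> k) \<subseteq> (\<Union>i\<in>I. V i)"
      proof
        fix a assume a: "a \<in> A (\<phi> k)"
        obtain p where "p \<in> F" "infdist a F = dist a p"
          using infdist_attains_inf[OF compact_imp_closed[OF F(2)] F(1), of a] by blast
        moreover have "infdist a F < e"
          using elim(1) a by blast
        ultimately have "a \<in> (\<Union>p\<in>F. ball p e)"
          by (auto simp: dist_commute)
        then show "a \<in> (\<Union>i\<in>I. V i)"
          using e(2) by blast
      qed
      then show ?case
        using elim(2) V by (intro thickD[OF thick[of "\<phi> k", folded A_def] I, of V]) auto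
    qed
    have exp: "(\<lambda>k. \<alpha> - 1 / real (Suc (\<phi> k))) \<longlonglongrightarrow> \<alpha>"
      using tendsto_diff[OF tendsto_const inv] by simp
    show "b powr \<alpha> \<le> (\<Sum>i\<in>I. d i powr \<alpha>)"
    proof (rule tendsto_le[OF _ _ _ ev])
      show "(\<lambda>k. b powr (\<alpha> - 1 / real (Suc (\<phi> k)))) \<longlonglongrightarrow> b powr \<alpha>"
        using assms(4) by (intro tendsto_powr exp tendsto_const) auto
      show "(\<lambda>k. \<Sum>i\<in>I. d i powr (\<alpha> - 1 / real (Suc (\<phi> k)))) \<longlonglongrightarrow> (\<Sum>i\<in>I. d i powr \<alpha>)"
      proof (intro tendsto_sum tendsto_powr exp tendsto_const)
        show "d i \<noteq> 0" if "i \<in> I" for i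
          using V[OF that] by auto
      qed
    qed simp
  qed
  ultimately show ?thesis
    by blast
qed

text \<open>Only the ratio of the thick radius to the radius of the ball about \<open>x\<close>
  remains after magnification; it becomes the constant \<open>b\<close> of
  \<open>tangent_of_thick\<close>.\<close>

lemma thick_blow_up:
  fixes x :: "'a::real_normed_vector"
  assumes "thick \<epsilon> s R A" "R > 0" "\<epsilon> > 0" "T > 0" "A \<subseteq> K" "A \<subseteq> cball x T"
  shows "thick \<epsilon> s (R / T) ((\<lambda>y. (1 / T) *\<^sub>R (y - x)) ` K \<inter> cball 0 1)"
proof -
  have "thick \<epsilon> s (1 / T * R) ((\<lambda>y. (1 / T) *\<^sub>R (y - x)) ` A)"
  proof (rule thick_image[OF assms(1)])
    show "1 / T * dist u v \<le> dist ((1 / T) *\<^sub>R (u - x)) ((1 / T) *\<^sub>R (v - x))" for u v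
      using assms(4) by (simp add: dist_norm scaleR_diff_right[symmetric])
  qed (use assms in auto)
  moreover have "(\<lambda>y. (1 / T) *\<^sub>R (y - x)) ` A \<subseteq> (\<lambda>y. (1 / T) *\<^sub>R (y - x)) ` K \<inter> cball 0 1"
  proof -
    have "(1 / T) *\<^sub>R (y - x) \<in> cball 0 1" if "y \<in> A" for y
      using that assms(4,6) by (auto simp: subset_iff dist_norm norm_minus_commute divide_simps)
    then show ?thesis
      using assms(5) by auto
  qed
  ultimately show ?thesis
    using thick_mono by (metis mult.commute times_divide_eq_right mult_1)
qed

section \<open>Thick balls\<close>

text \<open>The constants are detached from the scale, which is enough wherever only dimensions are
  transported. Unlike \<open>self_embeddable\<close>, it is not vacuous for a single point, whose
  diameter is 0, so later arguments need no separate case for it.\<close>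

definition locally_self_embeddable :: "'a::metric_space set \<Rightarrow> bool" where
  "locally_self_embeddable K \<longleftrightarrow> (\<forall>z\<in>K. \<forall>t>0. \<exists>g c L. 0 < c \<and> c \<le> L \<and> g ` K \<subseteq> cball z t \<inter> K \<and>
     (\<forall>x\<in>K. \<forall>y\<in>K. c * dist x y \<le> dist (g x) (g y) \<and> dist (g x) (g y) \<le> L * dist x y))"

lemma locally_self_embeddableE:
  assumes "locally_self_embeddable K" "z \<in> K" "0 < t"
  obtains g c L where "0 < c" "c \<le> L" "g ` K \<subseteq> cball z t \<inter> K"
    "\<And>x y. x \<in> K \<Longrightarrow> y \<in> K \<Longrightarrow> c * dist x y \<le> dist (g x) (g y)"
    "\<And>x y. x \<in> K \<Longrightarrow> y \<in> K \<Longrightarrow> dist (g x) (g y) \<le> L * dist x y"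
proof -
  have "\<exists>g c L. 0 < c \<and> c \<le> L \<and> g ` K \<subseteq> cball z t \<inter> K \<and>
     (\<forall>x\<in>K. \<forall>y\<in>K. c * dist x y \<le> dist (g x) (g y) \<and> dist (g x) (g y) \<le> L * dist x y)"
    using assms(1)[unfolded locally_self_embeddable_def, rule_format, OF assms(2,3)] .
  then obtain g c L where "0 < c \<and> c \<le> L \<and> g ` K \<subseteq> cball z t \<inter> K \<and>
     (\<forall>x\<in>K. \<forall>y\<in>K. c * dist x y \<le> dist (g x) (g y) \<and> dist (g x) (g y) \<le> L * dist x y)"
    by (elim exE)
  then show thesis
    by (intro that[of c L g]) simp_all
qed

lemma self_embeddable_imp_local:
  assumes "bounded K" "self_embeddable K"
  shows "locally_self_embeddable K"
  unfolding locally_self_embeddable_def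
proof (intro ballI allI impI)
  fix z and t :: real assume z: "z \<in> K" and t: "t > 0"
  show "\<exists>g c L. 0 < c \<and> c \<le> L \<and> g ` K \<subseteq> cball z t \<inter> K \<and>
     (\<forall>x\<in>K. \<forall>y\<in>K. c * dist x y \<le> dist (g x) (g y) \<and> dist (g x) (g y) \<le> L * dist x y)"
  proof (cases "diameter K > 0")
    case True
    define r where "r = min t (diameter K)"
    have r: "0 < r" "r \<le> diameter K" "r \<le> t"
      using t True by (auto simp: r_def)
    then obtain a where a: "a > 0" "embeds_at_scale K z r a"
      using assms(2) z unfolding self_embeddable_def by blast
    then obtain f where f: "f ` K \<subseteq> cball z r \<inter> K"
      "\<And>x y. x \<in> K \<Longrightarrow> y \<in> K \<Longrightarrow> a * r * dist x y \<le> dist (f x) (f y) \<and>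
                     dist (f x) (f y) \<le> inverse a * r * dist x y"
      unfolding embeds_at_scale_def by blast
    have "cball z r \<subseteq> cball z t"
      using r by (simp add: subset_cball)
    \<comment> \<open>The maximum secures \<open>c \<le> L\<close> even if
      \<open>a > 1\<close>.\<close>
    moreover have "dist (f x) (f y) \<le> max (a * r) (inverse a * r) * dist x y" if "x \<in> K" "y \<in> K" for x y
      using f(2)[OF that] mult_right_mono[of "inverse a * r" "max (a * r) (inverse a * r)" "dist x y"]
      by simp
    ultimately show ?thesis
      using f a r by (intro exI[of _ f] exI[of _ "a * r"] exI[of _ "max (a * r) (inverse a * r)"]) auto
  next
    case False
    have "dist x y = 0" if "x \<in> K" "y \<in> K" for x y
      using diameter_bounded_bound[OF assms(1) that] False zero_le_dist[of x y] by linarith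
    then have "K = {z}"
      using z by force
    then show ?thesis
      using t by (intro exI[of _ id] exI[of _ 1]) auto
  qed
qed

text \<open>Thickness is tested on a cover by balls of equal radius uR/2, whose diameters are at
  most uR.\<close>

lemma thick_covering_num:
  fixes A :: "'a::heine_borel set"
  assumes "thick \<epsilon> s R A" "bounded A" "R > 0" "0 < u" "\<epsilon> \<le> u" "u \<le> 1/2"
  shows "1 \<le> real (covering_num (u * R / 2) A) * u powr s"
proof -
  obtain C where C: "finite C" "card C = covering_num (u * R / 2) A" "A \<subseteq> (\<Union>c\<in>C. cball c (u * R / 2))"
    using covering_num_cover[OF assms(2), of "u * R / 2"] assms(3,4) by auto
  obtain h where h: "bij_betw h {0..<card C} C"
    using ex_bij_betw_nat_finite[OF C(1)] by blast
  have "R powr s \<le> (\<Sum>i\<in>{0..<card C}. (u * R) powr s)"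
  proof (rule thickD[OF assms(1), of _ "\<lambda>i. cball (h i) (u * R / 2)"])
    show "A \<subseteq> (\<Union>i\<in>{0..<card C}. cball (h i) (u * R / 2))"
    proof
      fix x assume "x \<in> A"
      then obtain c where c: "c \<in> C" "x \<in> cball c (u * R / 2)"
        using C(3) by (meson UN_E subsetD)
      then obtain i where "i \<in> {0..<card C}" "c = h i"
        using bij_betw_imp_surj_on[OF h] by (metis imageE)
      then show "x \<in> (\<Union>i\<in>{0..<card C}. cball (h i) (u * R / 2))"
        using c(2) by blast
    qed
    show "\<epsilon> * R \<le> u * R" "u * R \<le> R / 2"
      using assms mult_right_mono[of u "1/2" R] by auto
    fix i x y assume "x \<in> cball (h i) (u * R / 2)" "y \<in> cball (h i) (u * R / 2)"
    then show "dist x y \<le> u * R"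
      using dist_triangle3[of x y "h i"] by simp
  qed simp
  then have "R powr s * 1 \<le> R powr s * (real (card C) * u powr s)"
    using assms by (simp add: powr_mult mult_ac)
  then show ?thesis
    using assms(3) C(2) by simp
qed

text \<open>Replacing each ball by the cover witnessing that it is not thick does not increase the \<open>s\<close>-dimensional
  size but decreases the radii at a definite rate, so after finitely many rounds all radii are
  comparable to \<open>r\<close>.\<close>
lemma covering_num_not_thick:
  fixes K :: "'a::heine_borel set"
  assumes "E \<subseteq> K" "0 < \<epsilon>" "\<epsilon> \<le> 1" "0 \<le> s"
    and thin: "\<And>y R. y \<in> E \<Longrightarrow> 0 < R \<Longrightarrow> R < \<rho> \<Longrightarrow> \<not> thick \<epsilon> s R (cball y R \<inter> K)"
    and "y \<in> E" "0 < r" "\<epsilon> * r \<le> R" "R < \<rho>"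
  shows "real (covering_num r (cball y R \<inter> E)) \<le> (R / (\<epsilon> * r)) powr s"
proof -
  have er: "0 < \<epsilon> * r"
    using assms by simp
  have base: "real (covering_num r (cball y R \<inter> E)) \<le> (R / (\<epsilon> * r)) powr s"
    if "R \<le> r" "\<epsilon> * r \<le> R" for y R
  proof -
    have "covering_num r (cball y R \<inter> E) \<le> 1"
      using that by (intro covering_num_small[of _ y]) auto
    also have "real 1 \<le> (R / (\<epsilon> * r)) powr s"
      using er that assms(4) by (simp add: ge_one_powr_ge_zero pos_le_divide_eq)
    finally show ?thesis
      by simp
  qed
  have "real (covering_num r (cball y R \<inter> E)) \<le> (R / (\<epsilon> * r)) powr s"
    if "y \<in> E" "\<epsilon> * r \<le> R" "R < \<rho>" "R \<le> 2 ^ n * r" for n y R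
    using that
  proof (induction n arbitrary: y R)
    case 0
    then show ?case
      using base by simp
  next
    case (Suc n)
    show ?case
    proof (cases "R \<le> r")
      case True
      then show ?thesis
        using base Suc by simp
    next
      case False
      have R: "0 < R" "r < R"
        using False assms by auto
      obtain I :: "nat set" and U d where I: "finite I"
        "\<forall>i\<in>I. \<epsilon> * R \<le> d i \<and> d i \<le> R / 2 \<and> (\<forall>x\<in>U i. \<forall>y\<in>U i. dist x y \<le> d i)"
        "cball y R \<inter> K \<subseteq> (\<Union>i\<in>I. U i)" "(\<Sum>i\<in>I. d i powr s) < R powr s"
        using thin[OF Suc.prems(1) R(1) Suc.prems(3)] unfolding thick_def not_all not_imp not_le by blast
      \<comment> \<open>Only pieces that meet \<open>E\<close> are kept, so that the smaller balls
        can again be centred in \<open>E\<close>, as the induction requires.\<close>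
      define J where "J = {i\<in>I. U i \<inter> E \<noteq> {}}"
      have J: "finite J" "J \<subseteq> I"
        using I by (auto simp: J_def)
      have "\<forall>i\<in>J. \<exists>p. p \<in> U i \<inter> E"
        by (auto simp: J_def)
      then obtain p where p: "\<And>i. i \<in> J \<Longrightarrow> p i \<in> U i \<inter> E"
        by metis
      have "covering_num r (cball y R \<inter> E) \<le> (\<Sum>i\<in>J. covering_num r (cball (p i) (d i) \<inter> E))"
      proof (rule covering_num_UN[OF J(1) _ assms(7)])
        show "bounded (cball (p i) (d i) \<inter> E)" for i
          by (intro bounded_Int disjI1 bounded_cball)
        show "cball y R \<inter> E \<subseteq> (\<Union>i\<in>J. cball (p i) (d i) \<inter> E)"
        proof
          fix x assume x: "x \<in> cball y R \<inter> E"
          then have "x \<in> (\<Union>i\<in>I. U i)"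
            using I(3) assms(1) by blast
          then obtain i where i: "i \<in> I" "x \<in> U i"
            by blast
          then have "i \<in> J"
            using x by (auto simp: J_def)
          moreover have "dist (p i) x \<le> d i"
            using I(2) i p[OF \<open>i \<in> J\<close>] by blast
          ultimately show "x \<in> (\<Union>i\<in>J. cball (p i) (d i) \<inter> E)"
            using x by auto
        qed
      qed
      then have "real (covering_num r (cball y R \<inter> E)) \<le> (\<Sum>i\<in>J. real (covering_num r (cball (p i) (d i) \<inter> E)))"
        by (metis of_nat_le_iff of_nat_sum)
      also have "\<dots> \<le> (\<Sum>i\<in>J. (d i / (\<epsilon> * r)) powr s)"
      proof (intro sum_mono Suc.IH)
        fix i assume i: "i \<in> J"
        then have d: "\<epsilon> * R \<le> d i" "d i \<le> R / 2"
          using I(2) J by auto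
        show "p i \<in> E"
          using p i by blast
        show "\<epsilon> * r \<le> d i"
          \<comment> \<open>Only balls with R > r are subdivided, so no new radius falls below
            \<open>\<epsilon> * r\<close>.\<close>
          using d R(2) assms(2) mult_left_mono[of r R \<epsilon>] by linarith
        show "d i < \<rho>" "d i \<le> 2 ^ n * r"
          using d Suc.prems R by auto
      qed
      also have "\<dots> \<le> (\<Sum>i\<in>I. (d i / (\<epsilon> * r)) powr s)"
        using I J by (intro sum_mono2) auto
      also have "\<dots> = (\<Sum>i\<in>I. d i powr s) / (\<epsilon> * r) powr s"
      proof -
        have "0 \<le> d i" if "i \<in> I" for i
        proof -
          have "0 < \<epsilon> * R" "\<epsilon> * R \<le> d i"
            using I(2) R assms that by auto
          then show ?thesis
            by linarith
        qed
        then show ?thesis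
          using er by (simp add: powr_divide sum_divide_distrib)
      qed
      also have "\<dots> \<le> R powr s / (\<epsilon> * r) powr s"
        using I(4) by (intro divide_right_mono) auto
      also have "\<dots> = (R / (\<epsilon> * r)) powr s"
        using R er by (simp add: powr_divide)
      finally show ?thesis .
    qed
  qed
  moreover obtain n where "R / r < 2 ^ n"
    using real_arch_pow[of 2 "R / r"] by auto
  then have "R \<le> 2 ^ n * r"
    using assms by (simp add: pos_divide_less_eq)
  ultimately show ?thesis
    using assms by blast
qed

text \<open>If all small balls centred in the piece of K near \<open>z\<close> were thin, the
  iteration would control the covering numbers of that piece. An embedding \<open>g\<close> of K
  into the piece carries a ball of radius R into one of radius L R, so the same exponent s would
  serve for K, against s < \<open>assouad_dim K\<close>. The iteration needs s \<ge> 0; for s \<le>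
  0 every ball is thick.\<close>

lemma thick_ball_exists:
  fixes K :: "'a::euclidean_space set"
  assumes "compact K" "locally_self_embeddable K" "z \<in> K" "t > 0" "0 < \<epsilon>" "\<epsilon> \<le> 1" "0 < \<rho>"
    and s: "s < assouad_dim K"
  shows "\<exists>y R. y \<in> cball z t \<inter> K \<and> 0 < R \<and> R < \<rho> \<and> thick \<epsilon> s R (cball y R \<inter> K)"
proof (cases "s \<le> 0")
  case True
  have "z \<in> cball z (\<rho> / 2) \<inter> K"
    using assms by simp
  then have "thick \<epsilon> s (\<rho> / 2) (cball z (\<rho> / 2) \<inter> K)"
    using True assms by (intro thick_nonpos) (blast | simp)+
  then show ?thesis
    using assms by (intro exI[of _ z] exI[of _ "\<rho> / 2"]) auto
next
  case False
  show ?thesis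
  proof (rule ccontr)
    assume "\<not> ?thesis"
    then have thin: "\<not> thick \<epsilon> s R (cball y R \<inter> K)" if "y \<in> cball z t \<inter> K" "0 < R" "R < \<rho>" for y R
      using that by blast
    obtain g c L where g: "0 < c" "c \<le> L" "g ` K \<subseteq> cball z t \<inter> K"
      "\<And>x y. x \<in> K \<Longrightarrow> y \<in> K \<Longrightarrow> c * dist x y \<le> dist (g x) (g y)"
      "\<And>x y. x \<in> K \<Longrightarrow> y \<in> K \<Longrightarrow> dist (g x) (g y) \<le> L * dist x y"
      using locally_self_embeddableE[OF assms(2-4)] by metis
    have L: "L > 0"
      using g by linarith
    have "assouad_exponent K s"
    proof (rule assouad_exponent_local[OF assms(1)])
      show "0 < \<rho> / L" "0 < (2 * L / (c * \<epsilon>)) powr s"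
        using assms g L by simp_all
      show "0 \<le> s"
        using False by simp
      fix x r R assume x: "x \<in> K" and r: "0 < r" "r \<le> R" "R < \<rho> / L"
      have "covering_num r (cball x R \<inter> K) \<le> covering_num (c * r / 2) (cball (g x) (L * R) \<inter> (cball z t \<inter> K))"
      proof (rule covering_num_embedding)
        show "g ` (cball x R \<inter> K) \<subseteq> cball (g x) (L * R) \<inter> (cball z t \<inter> K)"
        proof safe
          fix y assume y: "y \<in> cball x R" "y \<in> K"
          have "dist (g x) (g y) \<le> L * dist x y"
            using g x y by blast
          also have "\<dots> \<le> L * R"
            using y L by (intro mult_left_mono) auto
          finally show "g y \<in> cball (g x) (L * R)"
            by simp
        qed (use g in auto)
        show "c * dist x' y \<le> dist (g x') (g y)" if "x' \<in> cball x R \<inter> K" "y \<in> cball x R \<inter> K" for x' y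
          using g that by blast
      qed (use g r in auto)
      also have "real \<dots> \<le> (L * R / (\<epsilon> * (c * r / 2))) powr s"
      proof (rule covering_num_not_thick[OF _ assms(5,6) _ thin])
        show "g x \<in> cball z t \<inter> K"
          using g x by blast
        show "0 \<le> s"
          using False by simp
        show "L * R < \<rho>"
          using r L by (simp add: pos_less_divide_eq mult.commute)
        have "\<epsilon> * (c * r / 2) \<le> 1 * (c * r)"
          using assms g r by (intro mult_mono) auto
        also have "\<dots> \<le> L * R"
          using g r L by (simp add: mult_mono)
        finally show "\<epsilon> * (c * r / 2) \<le> L * R" .
      qed (use g r in auto)
      also have "L * R / (\<epsilon> * (c * r / 2)) = 2 * L / (c * \<epsilon>) * (R / r)"
        by (simp add: mult_ac)
      also have "\<dots> powr s = (2 * L / (c * \<epsilon>)) powr s * (R / r) powr s"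
        by (rule powr_mult)
      finally show "real (covering_num r (cball x R \<inter> K)) \<le> (2 * L / (c * \<epsilon>)) powr s * (R / r) powr s"
        by simp
    qed
    then have "assouad_dim K \<le> s"
      using assms(3) by (intro assouad_dim_le) auto
    then show False
      using s by simp
  qed
qed

text \<open>A single index drives the cutoff, the exponent deficit and the bound on the radius, so
  one sequence of such balls supplies everything a tangent needs in the limit.\<close>

definition thick_ball :: "'a::euclidean_space set \<Rightarrow> nat \<Rightarrow> 'a \<Rightarrow> real \<Rightarrow> bool" where
  "thick_ball K m y R \<longleftrightarrow> y \<in> K \<and> 0 < R \<and> R < 1 / real (Suc m) \<and>
     thick (1 / real (Suc m)) (assouad_dim K - 1 / real (Suc m)) R (cball y R \<inter> K)"

lemma thick_ball_near:
  fixes K :: "'a::euclidean_space set"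
  assumes "compact K" "locally_self_embeddable K" "z \<in> K" "t > 0"
  obtains y R where "y \<in> cball z t" "thick_ball K m y R"
proof -
  have "\<exists>y R. y \<in> cball z t \<inter> K \<and> 0 < R \<and> R < 1 / real (Suc m) \<and>
      thick (1 / real (Suc m)) (assouad_dim K - 1 / real (Suc m)) R (cball y R \<inter> K)"
    by (rule thick_ball_exists[OF assms]) auto
  then show thesis
    using that unfolding thick_ball_def by blast
qed

text \<open>The strict inequality makes the set relatively open, while the centres of thick balls,
  which are dense, belong to it. The intersection over all \<open>m\<close> is therefore residual in
  K; it is the set of generic points.\<close>

definition near_thick_ball :: "'a::euclidean_space set \<Rightarrow> nat \<Rightarrow> 'a set" where
  "near_thick_ball K m = {x\<in>K. \<exists>y R. thick_ball K m y R \<and> dist x y < R}"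

lemma near_thick_ball_subset: "near_thick_ball K m \<subseteq> K"
  by (auto simp: near_thick_ball_def)

lemma openin_near_thick_ball: "openin (top_of_set K) (near_thick_ball K m)"
proof -
  have eq: "near_thick_ball K m = K \<inter> \<Union>{ball y R | y R. thick_ball K m y R}"
    unfolding near_thick_ball_def by (auto simp: dist_commute) (metis dist_commute mem_ball)+
  have "open (\<Union>{ball y R | y R. thick_ball K m y R})"
    by (intro open_Union) auto
  then show ?thesis
    unfolding eq by (rule openin_open_Int)
qed

lemma near_thick_ball_dense:
  assumes "compact K" "locally_self_embeddable K"
  shows "K \<subseteq> closure (near_thick_ball K m)"
proof
  fix z assume z: "z \<in> K"
  show "z \<in> closure (near_thick_ball K m)"
    unfolding closure_approachable
  proof (intro allI impI)
    fix e :: real assume "e > 0"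
    then obtain y R where y: "y \<in> cball z (e / 2)" "thick_ball K m y R"
      using thick_ball_near[OF assms z, of "e / 2"] by (metis half_gt_zero)
    then have "y \<in> near_thick_ball K m"
      unfolding near_thick_ball_def thick_ball_def by fastforce
    moreover have "dist y z < e"
      using y \<open>e > 0\<close> by (simp add: dist_commute)
    ultimately show "\<exists>y\<in>near_thick_ball K m. dist y z < e"
      by blast
  qed
qed

lemma cball_Int_subset_double:
  fixes x y :: "'a::metric_space"
  assumes "dist x y < R"
  shows "cball y R \<inter> K \<subseteq> cball x (2 * R) \<inter> K"
proof -
  have "dist x z \<le> 2 * R" if "dist y z \<le> R" for z
    using dist_triangle[of x z y] assms that by linarith
  then show ?thesis
    by auto
qed

lemma inverse_scales_at_top:
  assumes "\<And>m. 0 < T m" "\<And>m. T m \<le> M / real (Suc m)"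
  shows "filterlim (\<lambda>m. 1 / T m) at_top sequentially"
proof (rule filterlim_at_top_mono)
  have M: "M > 0"
    using assms(1)[of 0] assms(2)[of 0] by simp
  show "filterlim (\<lambda>m. real (Suc m) / M) at_top sequentially"
    using M by real_asymp
  show "\<forall>\<^sub>F m in sequentially. real (Suc m) / M \<le> 1 / T m"
  proof (intro always_eventually allI)
    fix m
    have "T m * real (Suc m) \<le> M"
      using assms(2)[of m] by (simp add: pos_le_divide_eq)
    then show "real (Suc m) / M \<le> 1 / T m"
      using M assms(1)[of m] by (simp add: frac_le_eq divide_simps mult.commute)
  qed
qed

text \<open>A thick ball near \<open>x\<close> is not centred at \<open>x\<close> and is caught in the ball of twice its radius about \<open>x\<close>,
  which costs the factor \<open>2 powr - assouad_dim K\<close>.\<close>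
lemma tangent_near_thick_balls:
  fixes K :: "'a::euclidean_space set"
  assumes "compact K" "x \<in> K" and x: "\<And>m. x \<in> near_thick_ball K m"
  shows "\<exists>F\<in>Tan K x. ennreal (2 powr (- assouad_dim K)) \<le> hausdorff_measure (assouad_dim K) F"
proof -
  have "\<forall>m. \<exists>y R. thick_ball K m y R \<and> dist x y < R"
    using x by (auto simp: near_thick_ball_def)
  then obtain y R where yR: "\<And>m. thick_ball K m (y m) (R m)" "\<And>m. dist x (y m) < R m"
    by metis
  have R: "\<And>m. 0 < R m" "\<And>m. R m < 1 / real (Suc m)"
    using yR(1) by (auto simp: thick_ball_def)
  have "\<exists>F\<in>Tan K x. ennreal ((1/2) powr assouad_dim K) \<le> hausdorff_measure (assouad_dim K) F"
  proof (rule tangent_of_thick[OF assms(1,2)])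
    show "0 \<le> assouad_dim K"
      using assms(2) by (intro assouad_dim_nonneg) auto
    show "0 < 1 / (2 * R m)" for m
      using R(1) by simp
    show "filterlim (\<lambda>m. 1 / (2 * R m)) at_top sequentially"
    proof (rule inverse_scales_at_top)
      show "2 * R m \<le> 2 / real (Suc m)" for m
        using R(2)[of m] by simp
    qed (use R in simp)
    fix m
    have "thick (1 / real (Suc m)) (assouad_dim K - 1 / real (Suc m)) (R m) (cball (y m) (R m) \<inter> K)"
      using yR(1)[of m] by (simp add: thick_ball_def)
    then have "thick (1 / real (Suc m)) (assouad_dim K - 1 / real (Suc m)) (R m / (2 * R m))
        ((\<lambda>y. (1 / (2 * R m)) *\<^sub>R (y - x)) ` K \<inter> cball 0 1)"
      by (rule thick_blow_up) (use R(1)[of m] cball_Int_subset_double[OF yR(2)[of m], of K] in auto)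
    then show "thick (1 / real (Suc m)) (assouad_dim K - 1 / real (Suc m)) (1/2)
        ((\<lambda>y. (1 / (2 * R m)) *\<^sub>R (y - x)) ` K \<inter> cball 0 1)"
      using R(1)[of m] by simp
  qed simp
  then show ?thesis
    by (simp add: powr_minus powr_divide inverse_eq_divide)
qed

text \<open>An exponent s below \<open>assouad_dim K\<close> would allow at most C (4/u)^s balls of
  radius uR/2 for the ball of radius 2R about \<open>x\<close>. A thick ball inside it needs at
  least u^(-t) of them, with t > s, which is impossible once u is small.\<close>

lemma pointwise_assouad_dim_near_thick_balls:
  fixes K :: "'a::euclidean_space set"
  assumes "x \<in> K" and x: "\<And>m. x \<in> near_thick_ball K m"
  shows "pointwise_assouad_dim K x = assouad_dim K"
proof (rule ccontr)
  assume "\<not> ?thesis"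
  then have "pointwise_assouad_dim K x < assouad_dim K"
    using pointwise_assouad_dim_le_assouad_dim[OF assms(1)] by simp
  then obtain s where s: "pointwise_assouad_exponent K x s" "s < assouad_dim K"
    using pointwise_assouad_dim_less[OF assms(1)] by blast
  then obtain C \<rho> where C: "C > 0" "\<rho> > 0"
    "\<And>r R. 0 < r \<Longrightarrow> r \<le> R \<Longrightarrow> R < \<rho> \<Longrightarrow> real (covering_num r (cball x R \<inter> K)) \<le> C * (R / r) powr s"
    unfolding pointwise_assouad_exponent_def by blast
  define t where "t = (s + assouad_dim K) / 2"
  have t: "s < t" "t < assouad_dim K"
    using s by (auto simp: t_def)
  have "((\<lambda>u. C * 4 powr s * u powr (t - s)) \<longlongrightarrow> C * 4 powr s * 0) (at_right 0)"
    using t by (intro tendsto_mult_left) real_asymp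
  then have "\<forall>\<^sub>F u in at_right 0. C * 4 powr s * u powr (t - s) < 1"
    by (intro order_tendstoD(2)[of _ 0]) auto
  moreover have "\<forall>\<^sub>F u in at_right (0::real). u \<in> {0<..<1/2}"
    by (rule eventually_at_right_real) simp
  ultimately have "\<forall>\<^sub>F u in at_right 0. C * 4 powr s * u powr (t - s) < 1 \<and> u \<in> {0<..<1/2}"
    by eventually_elim auto
  then obtain u where u: "C * 4 powr s * u powr (t - s) < 1" "0 < u" "u < 1/2"
    using eventually_happens'[OF trivial_limit_at_right_real] by auto
  have inv: "(\<lambda>m. 1 / real (Suc m)) \<longlonglongrightarrow> 0"
    using LIMSEQ_inverse_real_of_nat by (simp add: inverse_eq_divide)
  have "\<forall>\<^sub>F m in sequentially. 1 / real (Suc m) < min u (min (\<rho> / 2) (assouad_dim K - t))"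
    using inv u C t by (intro order_tendstoD(2)[of _ 0]) auto
  \<comment> \<open>The proportion \<open>u\<close> is fixed before \<open>m\<close>, so that the
    cutoff 1/(m+1) lies below it; the other two bounds give 2R < \<rho> and an exponent above
    \<open>t\<close>.\<close>
  then obtain m where m: "1 / real (Suc m) < min u (min (\<rho> / 2) (assouad_dim K - t))"
    using eventually_happens'[OF sequentially_bot] by blast
  let ?\<epsilon> = "1 / real (Suc m)" and ?s = "assouad_dim K - 1 / real (Suc m)"
  obtain y R where y: "y \<in> K" "0 < R" "R < ?\<epsilon>" "dist x y < R" "thick ?\<epsilon> ?s R (cball y R \<inter> K)"
    using x[of m] unfolding near_thick_ball_def thick_ball_def by blast
  have "thick ?\<epsilon> ?s R (cball x (2 * R) \<inter> K)"
    using thick_mono[OF y(5) cball_Int_subset_double[OF y(4)]] .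
  then have "1 \<le> real (covering_num (u * R / 2) (cball x (2 * R) \<inter> K)) * u powr ?s"
    using u y m by (intro thick_covering_num) auto
  also have "\<dots> \<le> (C * (2 * R / (u * R / 2)) powr s) * u powr ?s"
  proof (intro mult_right_mono C(3))
    have "u * R \<le> 4 * R"
      using u y by (intro mult_right_mono) auto
    then show "u * R / 2 \<le> 2 * R"
      by simp
  qed (use u y m in auto)
  also have "2 * R / (u * R / 2) = 4 / u"
    using y u by (simp add: field_simps)
  also have "C * (4 / u) powr s * u powr ?s \<le> C * (4 / u) powr s * u powr t"
    using u m C by (intro mult_left_mono powr_mono') auto
  also have "\<dots> = C * 4 powr s * u powr (t - s)"
    using u by (simp add: powr_divide powr_diff)
  finally show False
    using u by simp
qed

text \<open>Given countably many sets that cover P, the closure of one of them contains a relative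
  ball of K; otherwise the complements of the closures are open and dense, and by Baire they share a
  point with all the \<open>G m\<close>, which lies in P but in no set of the cover. K embeds in
  that relative ball, so the box dimension of this one set is at least that of K.\<close>

lemma packing_dim_residual:
  fixes K :: "'a::euclidean_space set"
  assumes "K \<noteq> {}" "compact K" "locally_self_embeddable K"
    and G: "\<And>m::nat. openin (top_of_set K) (G m)" "\<And>m. K \<subseteq> closure (G m)"
    and P: "(\<Inter>m. G m) \<subseteq> P" "P \<subseteq> K"
  shows "packing_dim P = packing_dim K"
proof (rule antisym)
  show "packing_dim P \<le> packing_dim K"
    using P by (intro packing_dim_mono)
  have bK: "bounded K"
    using assms(2) compact_imp_bounded by blast
  have "packing_dim K \<le> (SUP i. upper_box_dim (U i))"
    if U: "\<And>i. bounded (U i)" "P \<subseteq> (\<Union>i. U i)" for U :: "nat \<Rightarrow> 'a set"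
  proof -
    have "\<exists>i. \<exists>z\<in>K. \<exists>t>0. cball z t \<inter> K \<subseteq> closure (U i)"
    proof (rule ccontr)
      assume no: "\<nexists>i. \<exists>z\<in>K. \<exists>t>0. cball z t \<inter> K \<subseteq> closure (U i)"
      define V where "V i = K - closure (U i)" for i
      have V: "openin (top_of_set K) (V i)" for i
        unfolding V_def Diff_eq by (intro openin_open_Int open_Compl closed_closure)
      have dense: "K \<subseteq> closure (V i)" for i
      proof
        fix z assume z: "z \<in> K"
        show "z \<in> closure (V i)"
          unfolding closure_approachable
        proof (intro allI impI)
          fix e :: real assume "e > 0"
          then have "\<not> cball z (e / 2) \<inter> K \<subseteq> closure (U i)"
            using no z half_gt_zero by blast
          then obtain y where "y \<in> cball z (e / 2)" "y \<in> V i"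
            unfolding V_def by blast
          then show "\<exists>y\<in>V i. dist y z < e"
            using \<open>e > 0\<close> by (intro bexI[of _ y]) (auto simp: dist_commute)
        qed
      qed
      have "openin (top_of_set K) T \<and> K \<subseteq> closure T" if "T \<in> range G \<union> range V" for T
        using V G dense that by blast
      then have "K \<subseteq> closure (\<Inter>(range G \<union> range V))"
        by (intro Baire compact_imp_closed assms(2)) simp_all
      moreover have "\<Inter>(range G \<union> range V) = {}"
      proof -
        have False if "x \<in> \<Inter>(range G \<union> range V)" for x
        proof -
          have "x \<in> (\<Inter>m. G m)"
            using that by blast
          then obtain i where "x \<in> U i"
            using P U by blast
          moreover have "x \<in> V i"
            using that by blast
          ultimately show False
            using closure_subset[of "U i"] by (auto simp: V_def)
        qed
        then show ?thesis
          by blast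
      qed
      ultimately show False
        using assms(1) by auto
    qed
    then obtain i z t where iz: "z \<in> K" "t > 0" "cball z t \<inter> K \<subseteq> closure (U i)"
      by blast
    obtain g c L where g: "0 < c" "c \<le> L" "g ` K \<subseteq> cball z t \<inter> K"
      "\<And>x y. x \<in> K \<Longrightarrow> y \<in> K \<Longrightarrow> c * dist x y \<le> dist (g x) (g y)"
      using locally_self_embeddableE[OF assms(3) iz(1,2)] by metis
    have "packing_dim K \<le> upper_box_dim K"
      by (rule packing_dim_le_upper_box_dim[OF bK])
    also have "\<dots> \<le> upper_box_dim (closure (U i))"
    proof (rule upper_box_dim_embedding[OF assms(1) bK bounded_closure[OF U(1)] _ g(1) g(4)])
      show "g ` K \<subseteq> closure (U i)"
        using g(3) iz(3) by (rule subset_trans)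
    qed
    also have "\<dots> = upper_box_dim (U i)"
      by (rule upper_box_dim_closure)
    also have "\<dots> \<le> (SUP i. upper_box_dim (U i))"
      by (intro SUP_upper) simp
    finally show ?thesis .
  qed
  then show "packing_dim K \<le> packing_dim P"
    unfolding packing_dim_def[of P] by (intro INF_greatest) auto
qed

text \<open>One fixed radius R about \<open>x\<close> suffices: K embeds in its part inside that
  ball, and the pointwise bound with R fixed is a box counting bound up to a constant.\<close>

lemma upper_box_dim_le_pointwise_assouad_dim:
  fixes K :: "'a::euclidean_space set"
  assumes "compact K" "locally_self_embeddable K" "x \<in> K"
  shows "upper_box_dim K \<le> ereal (pointwise_assouad_dim K x)"
proof (rule dense_ge)
  fix t' assume "ereal (pointwise_assouad_dim K x) < t'"
  then obtain t where t: "ereal (pointwise_assouad_dim K x) < ereal t" "ereal t < t'"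
    using ereal_dense2 by blast
  then obtain s where s: "pointwise_assouad_exponent K x s" "s < t"
    using pointwise_assouad_dim_less[OF assms(3), of t] by auto
  then obtain C \<rho> where C: "C > 0" "\<rho> > 0"
    "\<And>r R. 0 < r \<Longrightarrow> r \<le> R \<Longrightarrow> R < \<rho> \<Longrightarrow> real (covering_num r (cball x R \<inter> K)) \<le> C * (R / r) powr s"
    unfolding pointwise_assouad_exponent_def by blast
  define R where "R = \<rho> / 2"
  have R: "0 < R" "R < \<rho>"
    using C by (auto simp: R_def)
  obtain g c L where g: "0 < c" "c \<le> L" "g ` K \<subseteq> cball x R \<inter> K"
    "\<And>x y. x \<in> K \<Longrightarrow> y \<in> K \<Longrightarrow> c * dist x y \<le> dist (g x) (g y)"
    using locally_self_embeddableE[OF assms(2,3) R(1)] by metis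
  have "upper_box_dim K \<le> ereal s"
  proof (rule upper_box_dim_le)
    show "K \<noteq> {}" "bounded K"
      using assms compact_imp_bounded by auto
    show "0 < C * (2 * R / c) powr s"
      using C R g by simp
    have "\<forall>\<^sub>F r in at_right (0::real). r \<in> {0<..<R / c}"
      using R g by (intro eventually_at_right_real) simp
    then show "\<forall>\<^sub>F r in at_right 0. real (covering_num r K) \<le> C * (2 * R / c) powr s * (1 / r) powr s"
    proof eventually_elim
      case (elim r)
      then have r: "0 < r" "c * r < R"
        using g by (auto simp: pos_less_divide_eq mult.commute)
      have split: "(2 * R / c * (1 / r)) powr s = (2 * R / c) powr s * (1 / r) powr s"
        by (rule powr_mult)
      have "covering_num r K \<le> covering_num (c * r / 2) (cball x R \<inter> K)"
        using g r by (intro covering_num_embedding[of g K _ c]) auto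
      also have "real \<dots> \<le> C * (R / (c * r / 2)) powr s"
        using r g R by (intro C(3)) auto
      also have "R / (c * r / 2) = 2 * R / c * (1 / r)"
        by simp
      also note split
      finally show ?case
        by (simp add: mult.assoc)
    qed
  qed
  also have "\<dots> \<le> t'"
    using s t by (metis ereal_less_eq(3) less_imp_le order_trans)
  finally show "upper_box_dim K \<le> t'" .
qed

section \<open>Homogeneous Cantor sets\<close>

text \<open>Here \<open>k\<close> is the generation of \<open>w\<close> and \<open>i\<close> counts
  the generations below it; \<open>k\<close> is recorded because the children of a point depend on
  its generation.\<close>

primrec descendants :: "(nat \<Rightarrow> 'a \<Rightarrow> 'a set) \<Rightarrow> nat \<Rightarrow> nat \<Rightarrow> 'a \<Rightarrow> 'a set" where
  "descendants ch k 0 w = {w}"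
| "descendants ch k (Suc i) w = (\<Union>z\<in>descendants ch k i w. ch (k + i) z)"

text \<open>The bound \<open>B\<close> on the branching stands in for a lower bound on
  \<rho>(n+1)/\<rho>(n), which is not assumed: levels may be arbitrarily sparse. The hypothesis
  \<open>mass\<close> says that the uniform distribution on generation n gives each point at most
  \<rho>(n)^u / c0, where c0 is \<open>c\<^sub>0\<close>. Descendants drift by less than 2\<rho>, so
  the separation 8\<rho> leaves gaps of 4\<rho> between families.\<close>

locale cantor_tree =
  fixes K :: "'a::euclidean_space set" and ch :: "nat \<Rightarrow> 'a \<Rightarrow> 'a set" and \<rho> :: "nat \<Rightarrow> real"
    and N :: "nat \<Rightarrow> nat" and root :: 'a and u c\<^sub>0 B :: real
  assumes compact_K: "compact K" and root: "root \<in> K"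
    and ch_subset: "\<And>n z. z \<in> K \<Longrightarrow> ch n z \<subseteq> K \<inter> cball z (\<rho> n)"
    and finite_ch: "\<And>n z. z \<in> K \<Longrightarrow> finite (ch n z)"
    and card_ch: "\<And>n z. z \<in> K \<Longrightarrow> card (ch n z) = N n"
    and ch_separated: "\<And>n z v w. z \<in> K \<Longrightarrow> v \<in> ch n z \<Longrightarrow> w \<in> ch n z \<Longrightarrow> v \<noteq> w \<Longrightarrow> 8 * \<rho> (Suc n) \<le> dist v w"
    and \<rho>_pos: "\<And>n. 0 < \<rho> n" and \<rho>_half: "\<And>n. \<rho> (Suc n) \<le> \<rho> n / 2"
    and N_pos: "\<And>n. 1 \<le> N n" and N_le: "\<And>n. real (N n) \<le> B"
    and u_nonneg: "0 \<le> u" and c0_pos: "0 < c\<^sub>0"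
    and mass: "\<And>n. c\<^sub>0 \<le> real (\<Prod>j<n. N j) * \<rho> n powr u"
begin

abbreviation D where "D \<equiv> descendants ch"

definition Z :: "nat \<Rightarrow> 'a set" where "Z n = D 0 n root"

lemma Z_0: "Z 0 = {root}" and Z_Suc: "Z (Suc n) = (\<Union>z\<in>Z n. ch n z)"
  by (simp_all add: Z_def)

lemma D_subset: "w \<in> K \<Longrightarrow> D k i w \<subseteq> K"
proof (induction i)
  case (Suc i)
  then show ?case
    using ch_subset[of _ "k + i"] by (auto simp: subset_iff)
qed simp

lemma finite_D: "w \<in> K \<Longrightarrow> finite (D k i w)"
proof (induction i)
  case (Suc i)
  then show ?case
    using D_subset[of w k i] by (auto simp: subset_iff intro!: finite_ch)
qed simp

text \<open>The steps \<rho>(k), \<rho>(k+1), ... are summed geometrically; the subtracted term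
  carries the induction, since \<rho>(k+i) \<le> 2\<rho>(k+i) - 2\<rho>(k+i+1).\<close>

lemma D_dist: "w \<in> K \<Longrightarrow> v \<in> D k i w \<Longrightarrow> dist w v \<le> 2 * \<rho> k - 2 * \<rho> (k + i)"
proof (induction i arbitrary: v)
  case (Suc i)
  then obtain z where z: "z \<in> D k i w" "v \<in> ch (k + i) z"
    by auto
  then have "z \<in> K"
    using D_subset Suc.prems by blast
  then have "dist z v \<le> \<rho> (k + i)"
    using ch_subset[of z "k + i"] z by auto
  moreover have "dist w z \<le> 2 * \<rho> k - 2 * \<rho> (k + i)"
    using Suc z by blast
  ultimately show ?case
    using dist_triangle[of w v z] \<rho>_half[of "k + i"] by simp
qed simp

lemma card_D: "w \<in> K \<Longrightarrow> card (D k i w) \<le> (\<Prod>j<i. N (k + j))"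
proof (induction i)
  case (Suc i)
  have "card (D k (Suc i) w) \<le> (\<Sum>z\<in>D k i w. card (ch (k + i) z))"
    using finite_D[OF Suc.prems] by (simp add: card_UN_le)
  also have "\<dots> = (\<Sum>z\<in>D k i w. N (k + i))"
    using D_subset[OF Suc.prems] card_ch by (intro sum.cong) (auto simp: subset_iff)
  also have "\<dots> = card (D k i w) * N (k + i)"
    by simp
  also have "\<dots> \<le> (\<Prod>j<Suc i. N (k + j))"
    using Suc by simp
  finally show ?case .
qed simp

lemma Z_subset: "Z n \<subseteq> K" and finite_Z: "finite (Z n)"
  using D_subset[OF root] finite_D[OF root] by (auto simp: Z_def)

lemma Z_separated: "v \<in> Z n \<Longrightarrow> w \<in> Z n \<Longrightarrow> v \<noteq> w \<Longrightarrow> 8 * \<rho> n \<le> dist v w"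
proof (induction n arbitrary: v w)
  case (Suc n)
  obtain y z where yz: "y \<in> Z n" "z \<in> Z n" "v \<in> ch n y" "w \<in> ch n z"
    using Suc.prems by (auto simp: Z_Suc)
  have K: "y \<in> K" "z \<in> K"
    using yz Z_subset by auto
  show ?case
  proof (cases "y = z")
    case True
    then show ?thesis
      using ch_separated[OF K(1)] yz Suc.prems by simp
  next
    case False
    have "dist y v \<le> \<rho> n" "dist z w \<le> \<rho> n"
      using ch_subset[OF K(1), of n] ch_subset[OF K(2), of n] yz by auto
    moreover have "8 * \<rho> n \<le> dist y z"
      using Suc.IH yz False by blast
    \<comment> \<open>Each child moves by at most \<rho>(n), which leaves 6\<rho>(n) \<ge>
      12\<rho>(n+1).\<close>
    ultimately show ?thesis
      using dist_triangle[of y z v] dist_triangle[of v z w] \<rho>_half[of n] \<rho>_pos[of n] by (simp add: dist_commute)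
  qed
qed (simp add: Z_0)

lemma card_Z: "card (Z n) = (\<Prod>j<n. N j)"
proof (induction n)
  case (Suc n)
  have "card (\<Union>z\<in>Z n. ch n z) = (\<Sum>z\<in>Z n. card (ch n z))"
  proof (rule card_UN_disjoint)
    show "\<forall>i\<in>Z n. finite (ch n i)"
      using Z_subset finite_ch by blast
    show "\<forall>i\<in>Z n. \<forall>j\<in>Z n. i \<noteq> j \<longrightarrow> ch n i \<inter> ch n j = {}"
    proof (intro ballI impI)
      fix y z assume yz: "y \<in> Z n" "z \<in> Z n" "y \<noteq> z"
      have False if "v \<in> ch n y" "v \<in> ch n z" for v
      proof -
        have "y \<in> K" "z \<in> K"
          using yz Z_subset by auto
        then have "dist y v \<le> \<rho> n" "dist z v \<le> \<rho> n"
          using ch_subset[of y n] ch_subset[of z n] that by auto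
        then show False
          using Z_separated[OF yz] dist_triangle2[of y z v] \<rho>_pos[of n] by simp
      qed
      then show "ch n y \<inter> ch n z = {}"
        by blast
    qed
  qed (rule finite_Z)
  also have "\<dots> = (\<Sum>z\<in>Z n. N n)"
    using Z_subset card_ch by (intro sum.cong) auto
  finally show ?case
    using Suc by (simp add: Z_Suc)
qed (simp add: Z_0)

lemma Z_add: "Z (k + i) = (\<Union>w\<in>Z k. D k i w)"
  by (induction i) (auto simp: Z_Suc)

text \<open>Two families of generation k are separated by 8\<rho>(k) minus the two drifts of at most
  2\<rho>(k) each, so a set of diameter below 4\<rho>(k) meets the descendants of one point
  only.\<close>

lemma card_Z_Int:
  assumes "\<And>x y. x \<in> U \<Longrightarrow> y \<in> U \<Longrightarrow> dist x y \<le> d" "d < 4 * \<rho> k"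
  shows "card (Z (k + i) \<inter> U) \<le> (\<Prod>j<i. N (k + j))"
proof (cases "Z (k + i) \<inter> U = {}")
  case False
  then obtain v where v: "v \<in> Z (k + i)" "v \<in> U"
    by blast
  then obtain w where w: "w \<in> Z k" "v \<in> D k i w"
    by (auto simp: Z_add)
  have "Z (k + i) \<inter> U \<subseteq> D k i w"
  proof
    fix v' assume v': "v' \<in> Z (k + i) \<inter> U"
    then obtain w' where w': "w' \<in> Z k" "v' \<in> D k i w'"
      by (auto simp: Z_add)
    have "dist w v \<le> 2 * \<rho> k - 2 * \<rho> (k + i)" "dist w' v' \<le> 2 * \<rho> k - 2 * \<rho> (k + i)"
      using D_dist w w' Z_subset by blast+
    moreover have "dist v v' \<le> d"
      using assms(1) v v' by blast
    ultimately have "dist w w' < 8 * \<rho> k"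
      using assms(2) \<rho>_pos[of "k + i"] dist_triangle[of w w' v] dist_triangle[of v w' v']
      by (simp add: dist_commute)
    then have "w = w'"
      using Z_separated[OF w(1) w'(1)] by force
    then show "v' \<in> D k i w"
      using w' by simp
  qed
  then have "card (Z (k + i) \<inter> U) \<le> card (D k i w)"
    using w Z_subset by (intro card_mono finite_D) auto
  also have "\<dots> \<le> (\<Prod>j<i. N (k + j))"
    using w Z_subset by (intro card_D) auto
  finally show ?thesis .
qed simp

lemma \<rho>_le: "\<rho> n \<le> \<rho> 0 / 2 ^ n"
proof (induction n)
  case (Suc n)
  then show ?case
    using \<rho>_half[of n] by simp
qed simp

lemma scale_exists:
  assumes "0 < d" "d < 4 * \<rho> 0"
  obtains k where "4 * \<rho> (Suc k) \<le> d" "d < 4 * \<rho> k"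
proof -
  have "\<exists>n. 4 * \<rho> n \<le> d"
  proof -
    obtain n where "4 * \<rho> 0 / d < 2 ^ n"
      using real_arch_pow[of 2 "4 * \<rho> 0 / d"] by auto
    then have "4 * (\<rho> 0 / 2 ^ n) \<le> d"
      using assms(1) by (simp add: field_simps)
    then show ?thesis
      using \<rho>_le[of n] by (intro exI[of _ n]) linarith
  qed
  define n where "n = (LEAST n. 4 * \<rho> n \<le> d)"
  have n: "4 * \<rho> n \<le> d"
    unfolding n_def using \<open>\<exists>n. 4 * \<rho> n \<le> d\<close> by (rule LeastI_ex)
  then have "n \<noteq> 0"
    using assms(2) by (intro notI) simp
  then obtain k where k: "n = Suc k"
    using not0_implies_Suc by blast
  have "\<not> 4 * \<rho> k \<le> d"
    by (rule not_less_Least) (simp add: k[symmetric] n_def[symmetric], simp add: k)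
  then show thesis
    using that[of k] n k by simp
qed

text \<open>The radius 2\<rho>(n) makes the sets nested, as \<rho>(n) + 2\<rho>(n+1) \<le>
  2\<rho>(n).\<close>

definition E :: "nat \<Rightarrow> 'a set" where "E n = K \<inter> (\<Union>z\<in>Z n. cball z (2 * \<rho> n))"

definition limit_set :: "'a set" where "limit_set = (\<Inter>n. E n)"

lemma compact_E: "compact (E n)"
  unfolding E_def using compact_K finite_Z by (intro compact_Int_closed closed_UN) auto

lemma Z_subset_E: "Z n \<subseteq> E n"
  using Z_subset \<rho>_pos[of n] by (force simp: E_def)

lemma E_Suc: "E (Suc n) \<subseteq> E n"
proof
  fix x assume "x \<in> E (Suc n)"
  then obtain z w where x: "x \<in> K" "z \<in> Z n" "w \<in> ch n z" "dist w x \<le> 2 * \<rho> (Suc n)"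
    by (auto simp: E_def Z_Suc)
  then have "dist z w \<le> \<rho> n"
    using ch_subset[of z n] Z_subset by (auto simp: subset_iff)
  then have "dist z x \<le> 2 * \<rho> n"
    using x dist_triangle[of z x w] \<rho>_half[of n] by simp
  then show "x \<in> E n"
    using x by (auto simp: E_def)
qed

lemma E_antimono: "m \<le> n \<Longrightarrow> E n \<subseteq> E m"
  using E_Suc by (rule lift_Suc_antimono_le)

lemma compact_limit_set: "compact limit_set"
proof -
  have "limit_set = E 0 \<inter> (\<Inter>n. E n)"
    by (auto simp: limit_set_def)
  then show ?thesis
    using compact_E by (metis closed_INT compact_Int_closed compact_imp_closed)
qed

lemma limit_set_subset: "limit_set \<subseteq> K"
  by (auto simp: limit_set_def E_def)

text \<open>The parent \<open>z\<close> is kept because it determines the embedding that produced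
  \<open>w\<close>; a thick ball will be transported by that very embedding.\<close>

lemma limit_set_near:
  assumes "x \<in> limit_set"
  obtains z w where "z \<in> K" "w \<in> ch n z" "dist x w \<le> 2 * \<rho> (Suc n)"
proof -
  have "x \<in> E (Suc n)"
    using assms by (auto simp: limit_set_def)
  then obtain z w where "z \<in> Z n" "w \<in> ch n z" "dist w x \<le> 2 * \<rho> (Suc n)"
    by (auto simp: E_def Z_Suc)
  then show thesis
    using that[of z w] Z_subset by (auto simp: dist_commute)
qed

lemma open_cover_limit_set:
  assumes "open W" "limit_set \<subseteq> W"
  obtains n where "\<And>m. n \<le> m \<Longrightarrow> E m \<subseteq> W"
proof -
  have "\<exists>n. E n - W = {}"
  proof (rule ccontr)
    assume "\<nexists>n. E n - W = {}"
    then have "\<Inter>(range (\<lambda>n. E n - W)) \<noteq> {}"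
      using E_antimono assms(1) by (intro compact_nest compact_diff compact_E) blast+
    then show False
      using assms(2) by (auto simp: limit_set_def)
  qed
  then obtain n where "E n \<subseteq> W"
    by blast
  then show thesis
    using that E_antimono by (meson subset_trans)
qed

text \<open>A set of diameter about \<open>\<rho> k\<close> contains at most the proportion \<open>1 / \<Prod>j<k. N j\<close> of the points of any
  later generation.\<close>
lemma hausdorff_measure_limit_set: "hausdorff_measure u limit_set \<noteq> 0"
proof -
  define b where "b = B / (c\<^sub>0 * 4 powr u)"
  have B: "B > 0"
    using N_pos[of 0] N_le[of 0] by linarith
  then have b: "b > 0"
    using c0_pos by (simp add: b_def)
  define M where "M n = real (\<Prod>j<n. N j)" for n
  have M_pos: "M n > 0" for n
    unfolding M_def using N_pos by (simp add: prod_pos Suc_le_eq)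
  \<comment> \<open>The set may be far larger than \<rho>(k+1) or far smaller than \<rho>(k).
    Counting at scale k+1 loses only the factor \<open>N k\<close>, which is at most
    \<open>B\<close>.\<close>
  have weight: "1 \<le> M k * (b * d powr u)" if "4 * \<rho> (Suc k) \<le> d" for k d
  proof -
    have "c\<^sub>0 \<le> (M k * real (N k)) * \<rho> (Suc k) powr u"
      using mass[of "Suc k"] by (simp add: M_def)
    also have "\<dots> \<le> (M k * B) * (d / 4) powr u"
      using that \<rho>_pos[of "Suc k"] u_nonneg N_le[of k] M_pos[of k] B
      by (intro mult_mono powr_mono2) auto
    also have "\<dots> = c\<^sub>0 * (M k * (b * d powr u))"
      using c0_pos by (simp add: b_def powr_divide)
    finally show ?thesis
      using c0_pos by simp
  qed
  have "ennreal (1 / b) \<le> hausdorff_measure u limit_set"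
  proof (rule hausdorff_measure_ge[OF compact_limit_set u_nonneg])
    show "0 < 2 * \<rho> 0"
      using \<rho>_pos by simp
    fix I :: "nat set" and V d
    assume I: "finite I" and V: "\<And>i. i \<in> I \<Longrightarrow> open (V i) \<and> 0 < d i \<and> d i \<le> 2 * \<rho> 0 \<and>
        (\<forall>x\<in>V i. \<forall>y\<in>V i. dist x y \<le> d i)" and cov: "limit_set \<subseteq> (\<Union>i\<in>I. V i)"
    have "\<exists>k. 4 * \<rho> (Suc k) \<le> d i \<and> d i < 4 * \<rho> k" if "i \<in> I" for i
    proof (rule scale_exists)
      show "0 < d i" "d i < 4 * \<rho> 0"
        using V[OF that] \<rho>_pos[of 0] by auto
    qed blast
    then obtain k where k: "\<And>i. i \<in> I \<Longrightarrow> 4 * \<rho> (Suc (k i)) \<le> d i \<and> d i < 4 * \<rho> (k i)"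
      by metis
    have "open (\<Union>i\<in>I. V i)"
      using V by auto
    then obtain n\<^sub>0 where n0: "\<And>m. n\<^sub>0 \<le> m \<Longrightarrow> E m \<subseteq> (\<Union>i\<in>I. V i)"
      using open_cover_limit_set[OF _ cov] by metis
    \<comment> \<open>The sum is a common upper bound for all \<open>k i\<close>.\<close>
    define n where "n = n\<^sub>0 + (\<Sum>i\<in>I. k i)"
    have kn: "k i \<le> n" if "i \<in> I" for i
      using member_le_sum[of i I k] that I by (simp add: n_def)
    have "Z n \<subseteq> (\<Union>i\<in>I. V i)"
      using Z_subset_E[of n] n0[of n] by (auto simp: n_def)
    then have "Z n = (\<Union>i\<in>I. Z n \<inter> V i)"
      by blast
    then have "card (Z n) \<le> (\<Sum>i\<in>I. card (Z n \<inter> V i))"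
      using card_UN_le[OF I, of "\<lambda>i. Z n \<inter> V i"] by simp
    then have "M n \<le> (\<Sum>i\<in>I. real (card (Z n \<inter> V i)))"
      unfolding M_def card_Z[symmetric] by (metis of_nat_le_iff of_nat_sum)
    also have "\<dots> \<le> (\<Sum>i\<in>I. M n * (b * d i powr u))"
    proof (rule sum_mono)
      fix i assume i: "i \<in> I"
      define j where "j = n - k i"
      have n: "n = k i + j"
        using kn[OF i] by (simp add: j_def)
      have "card (Z n \<inter> V i) \<le> (\<Prod>l<j. N (k i + l))"
        unfolding n using V[OF i] k[OF i] by (intro card_Z_Int[of _ "d i"]) auto
      then have *: "M (k i) * real (card (Z n \<inter> V i)) \<le> M (k i) * real (\<Prod>l<j. N (k i + l))"
        using M_pos[of "k i"] by (intro mult_left_mono) (simp_all only: of_nat_le_iff less_imp_le)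
      have "M (k i) * real (\<Prod>l<j. N (k i + l)) = M n"
      proof -
        have "(\<Prod>l<k i + j. N l) = (\<Prod>l<k i. N l) * (\<Prod>l<j. N (k i + l))"
          by (induction j) (simp_all add: mult.assoc)
        then show ?thesis
          unfolding M_def n by simp
      qed
      with * have le: "M (k i) * real (card (Z n \<inter> V i)) \<le> M n"
        by simp
      have "real (card (Z n \<inter> V i)) * 1 \<le> real (card (Z n \<inter> V i)) * (M (k i) * (b * d i powr u))"
        using weight k[OF i] by (intro mult_left_mono) auto
      also have "\<dots> = (M (k i) * real (card (Z n \<inter> V i))) * (b * d i powr u)"
        by simp
      also have "\<dots> \<le> M n * (b * d i powr u)"
        using le b by (intro mult_right_mono) auto
      finally show "real (card (Z n \<inter> V i)) \<le> M n * (b * d i powr u)"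
        by simp
    qed
    also have "\<dots> = M n * (b * (\<Sum>i\<in>I. d i powr u))"
      by (simp add: sum_distrib_left)
    finally have "1 \<le> b * (\<Sum>i\<in>I. d i powr u)"
      using M_pos[of n] by simp
    then show "1 / b \<le> (\<Sum>i\<in>I. d i powr u)"
      using b by (simp add: pos_divide_le_eq mult.commute)
  qed
  moreover have "ennreal (1 / b) > 0"
    using b by simp
  ultimately show ?thesis
    by auto
qed

end

section \<open>Uniformly self-embeddable sets\<close>

lemma hausdorff_premeasure_le_card:
  fixes E :: "'a::real_normed_vector set"
  assumes "finite C" "E \<subseteq> (\<Union>c\<in>C. cball c \<delta>)" "0 < \<delta>" "0 < s" "2 * \<delta> \<le> \<Delta>"
  shows "hausdorff_premeasure s \<Delta> E \<le> ennreal (real (card C) * (2 * \<delta>) powr s)"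
proof -
  obtain h where h: "bij_betw h {0..<card C} C"
    using ex_bij_betw_nat_finite[OF assms(1)] by blast
  define U where "U i = (if i < card C then cball (h i) \<delta> else {})" for i
  have diam: "diameter (U i) \<le> 2 * \<delta>" for i
  proof (rule diameter_le)
    show "U i \<noteq> {} \<or> 0 \<le> 2 * \<delta>"
      using assms by simp
    fix x y assume "x \<in> U i" "y \<in> U i"
    then show "norm (x - y) \<le> 2 * \<delta>"
      using dist_triangle3[of x y "h i"] by (auto simp: U_def dist_norm split: if_splits)
  qed
  have bU: "bounded (U i)" for i
    by (simp add: U_def)
  have "E \<subseteq> (\<Union>i. U i)"
  proof
    fix x assume "x \<in> E"
    then obtain c where c: "c \<in> C" "x \<in> cball c \<delta>"
      using assms(2) by blast
    then obtain i where "i < card C" "c = h i"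
      using bij_betw_imp_surj_on[OF h] by (metis atLeastLessThan_iff imageE)
    then show "x \<in> (\<Union>i. U i)"
      using c by (auto simp: U_def)
  qed
  then have "hausdorff_premeasure s \<Delta> E \<le> (\<Sum>i. ennreal (diam_pow s (U i)))"
    unfolding hausdorff_premeasure_def using bU diam assms(5)
    by (intro INF_lower) (auto intro: order_trans)
  also have "\<dots> = (\<Sum>i\<in>{..<card C}. ennreal (diam_pow s (U i)))"
    by (rule suminf_finite) (auto simp: U_def diam_pow_def)
  also have "\<dots> \<le> (\<Sum>i\<in>{..<card C}. ennreal ((2 * \<delta>) powr s))"
  proof (intro sum_mono ennreal_leI)
    fix i
    show "diam_pow s (U i) \<le> (2 * \<delta>) powr s"
      using diam[of i] assms diameter_ge_0[OF bU[of i]]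
      by (auto simp: diam_pow_def intro!: powr_mono2)
  qed
  also have "\<dots> = ennreal (real (card C) * (2 * \<delta>) powr s)"
    by (simp add: ennreal_mult'' ennreal_of_nat_eq_real_of_nat)
  finally show ?thesis .
qed

text \<open>A maximal \<delta>-separated set is a \<delta>-net. If all of them had at most
  (c\<delta>)^(-u) points, then for u < t < dim_H K the t-dimensional cost of covering K would be a
  constant times \<delta>^(t-u), forcing measure 0. The gap t - u absorbs any constant c, which
  leaves room for the distortion of the embeddings.\<close>

lemma separated_set_exists:
  fixes K :: "'a::real_normed_vector set"
  assumes "0 \<le> u" "ereal u < hausdorff_dim K" "0 < c"
  shows "\<exists>\<delta> X. 0 < \<delta> \<and> \<delta> \<le> 1 \<and> finite X \<and> X \<subseteq> K \<and>
    (\<forall>x\<in>X. \<forall>y\<in>X. x \<noteq> y \<longrightarrow> \<delta> \<le> dist x y) \<and> 1 < real (card X) * (c * \<delta>) powr u"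
proof (rule ccontr)
  assume contr: "\<not> ?thesis"
  define sep where "sep \<delta> X \<longleftrightarrow> finite X \<and> X \<subseteq> K \<and> (\<forall>x\<in>X. \<forall>y\<in>X. x \<noteq> y \<longrightarrow> \<delta> \<le> dist x y)" for \<delta> X
  have small: "real (card X) * (c * \<delta>) powr u \<le> 1" if "0 < \<delta>" "\<delta> \<le> 1" "sep \<delta> X" for \<delta> X
  proof (rule ccontr)
    assume "\<not> ?thesis"
    then have "0 < \<delta> \<and> \<delta> \<le> 1 \<and> finite X \<and> X \<subseteq> K \<and>
        (\<forall>x\<in>X. \<forall>y\<in>X. x \<noteq> y \<longrightarrow> \<delta> \<le> dist x y) \<and> 1 < real (card X) * (c * \<delta>) powr u"
      using that unfolding sep_def not_le by simp
    with contr show False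
      by (elim notE) (intro exI)
  qed
  obtain t where t: "u < t" "ereal t < hausdorff_dim K"
    using ereal_dense2[OF assms(2)] by auto
  have pre: "hausdorff_premeasure t \<Delta> K \<le> ennreal (2 powr t / c powr u * \<delta> powr (t - u))"
    if \<delta>: "0 < \<delta>" "\<delta> \<le> 1" "2 * \<delta> \<le> \<Delta>" for \<delta> \<Delta>
  proof -
    have pw: "(c * \<delta>) powr u > 0"
      using \<delta> assms by simp
    \<comment> \<open>A largest separated set exists because the assumed bound limits all their
      cardinalities.\<close>
    have "\<exists>X. sep \<delta> X \<and> (\<forall>Y. sep \<delta> Y \<longrightarrow> card Y \<le> card X)"
    proof (rule ex_has_greatest_nat)
      show "sep \<delta> {}"
        by (simp add: sep_def)
      show "\<forall>Y. sep \<delta> Y \<longrightarrow> card Y < Suc (nat \<lceil>1 / (c * \<delta>) powr u\<rceil>)"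
      proof (intro allI impI)
        fix Y assume "sep \<delta> Y"
        then have "real (card Y) \<le> 1 / (c * \<delta>) powr u"
          using small[OF \<delta>(1,2)] pw by (simp add: pos_le_divide_eq)
        then show "card Y < Suc (nat \<lceil>1 / (c * \<delta>) powr u\<rceil>)"
          by linarith
      qed
    qed
    then obtain X where X: "sep \<delta> X" "\<And>Y. sep \<delta> Y \<Longrightarrow> card Y \<le> card X"
      by blast
    have fin: "finite X"
      using X(1) by (simp add: sep_def)
    have "K \<subseteq> (\<Union>x\<in>X. cball x \<delta>)"
    proof
      fix z assume z: "z \<in> K"
      show "z \<in> (\<Union>x\<in>X. cball x \<delta>)"
      proof (rule ccontr)
        assume no: "z \<notin> (\<Union>x\<in>X. cball x \<delta>)"
        then have far: "\<delta> < dist x z" if "x \<in> X" for x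
          using that by (simp add: not_le)
        then have "z \<notin> X"
          using \<delta>(1) by fastforce
        have "sep \<delta> (insert z X)"
          using X(1) z far by (auto simp: sep_def dist_commute less_imp_le)
        then have "card (insert z X) \<le> card X"
          by (rule X(2))
        then show False
          using \<open>z \<notin> X\<close> fin by simp
      qed
    qed
    then have "hausdorff_premeasure t \<Delta> K \<le> ennreal (real (card X) * (2 * \<delta>) powr t)"
      using fin \<delta> t assms by (intro hausdorff_premeasure_le_card) auto
    also have "\<dots> \<le> ennreal (1 / (c * \<delta>) powr u * (2 * \<delta>) powr t)"
      using small[OF \<delta>(1,2) X(1)] pw by (intro ennreal_leI mult_right_mono) (auto simp: pos_le_divide_eq)
    also have "1 / (c * \<delta>) powr u * (2 * \<delta>) powr t = 2 powr t / c powr u * \<delta> powr (t - u)"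
      by (simp add: powr_mult powr_diff)
    finally show ?thesis .
  qed
  have "hausdorff_premeasure t \<Delta> K = 0" if \<Delta>: "\<Delta> > 0" for \<Delta>
  proof -
    have "hausdorff_premeasure t \<Delta> K \<le> 0 + ennreal e" if e: "e > 0" for e
    proof -
      have "((\<lambda>\<delta>. 2 powr t / c powr u * \<delta> powr (t - u)) \<longlongrightarrow> 2 powr t / c powr u * 0) (at_right 0)"
        using t by (intro tendsto_mult_left) real_asymp
      then have "\<forall>\<^sub>F \<delta> in at_right 0. 2 powr t / c powr u * \<delta> powr (t - u) < e"
        using e by (intro order_tendstoD(2)) auto
      moreover have "\<forall>\<^sub>F \<delta> in at_right (0::real). \<delta> \<in> {0<..<min 1 (\<Delta> / 2)}"
        using \<Delta> by (intro eventually_at_right_real) simp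
      ultimately have "\<forall>\<^sub>F \<delta> in at_right 0. 2 powr t / c powr u * \<delta> powr (t - u) < e \<and> \<delta> \<in> {0<..<min 1 (\<Delta> / 2)}"
        by eventually_elim auto
      then obtain \<delta> where \<delta>: "2 powr t / c powr u * \<delta> powr (t - u) < e" "0 < \<delta>" "\<delta> < min 1 (\<Delta> / 2)"
        using eventually_happens'[OF trivial_limit_at_right_real] by auto
      have "hausdorff_premeasure t \<Delta> K \<le> ennreal (2 powr t / c powr u * \<delta> powr (t - u))"
        using \<delta> by (intro pre) auto
      also have "\<dots> \<le> ennreal e"
        using \<delta> by (intro ennreal_leI) simp
      finally show ?thesis
        by simp
    qed
    then have "hausdorff_premeasure t \<Delta> K \<le> 0"
      by (rule ennreal_le_epsilon)
    then show ?thesis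
      by simp
  qed
  then have "hausdorff_measure t K = 0"
    unfolding hausdorff_measure_def by (simp add: SUP_eq_const)
  then have "hausdorff_dim K \<le> ereal t"
    unfolding hausdorff_dim_def using t assms by (intro INF_lower) auto
  then show False
    using t by simp
qed

text \<open>Greedy scheduling: spend the factor \<open>g k\<close> as soon as the accumulated product can afford it.\<close>
lemma schedule_exists:
  fixes q :: real
  assumes "1 < q" "\<And>k. 0 < g k"
  obtains \<sigma> :: "nat \<Rightarrow> nat option" where "\<And>k. \<exists>n. \<sigma> n = Some k"
    "\<And>n. 1 \<le> (\<Prod>j<n. case \<sigma> j of None \<Rightarrow> q | Some k \<Rightarrow> g k)"
proof -
  \<comment> \<open>The state consists of the next index to be spent and the product accumulated so
    far.\<close>
  define st where "st = rec_nat (0::nat, 1::real)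
    (\<lambda>_ (k, W). if 1 \<le> W * g k then (Suc k, W * g k) else (k, W * q))"
  define \<sigma> where "\<sigma> n = (case st n of (k, W) \<Rightarrow> if 1 \<le> W * g k then Some k else None)" for n
  have st_0: "st 0 = (0, 1)"
    by (simp add: st_def)
  have st_Suc: "st (Suc n) = (case st n of (k, W) \<Rightarrow> if 1 \<le> W * g k then (Suc k, W * g k) else (k, W * q))" for n
    by (simp add: st_def)
  have W: "snd (st n) = (\<Prod>j<n. case \<sigma> j of None \<Rightarrow> q | Some k \<Rightarrow> g k) \<and> 1 \<le> snd (st n)" for n
  proof (induction n)
    case (Suc n)
    obtain k V where kV: "st n = (k, V)"
      by fastforce
    have "1 \<le> V * q"
      using Suc kV assms(1) mult_mono[of 1 V 1 q] by simp
    then show ?case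
      using Suc kV by (auto simp: st_Suc \<sigma>_def)
  qed (simp add: st_0)
  \<comment> \<open>While the index \<open>k\<close> waits, the product grows by \<open>q\<close> at
    every step, so it eventually affords \<open>g k\<close>.\<close>
  have hit: "\<exists>m. fst (st m) = k \<and> \<sigma> m = Some k" if "fst (st n) = k" for n k
  proof (rule ccontr)
    assume no: "\<nexists>m. fst (st m) = k \<and> \<sigma> m = Some k"
    have *: "st (n + i) = (k, snd (st n) * q ^ i)" for i
    proof (induction i)
      case 0
      then show ?case
        using that by (cases "st n") simp
    next
      case (Suc i)
      have "\<not> 1 \<le> snd (st n) * q ^ i * g k"
      proof
        assume "1 \<le> snd (st n) * q ^ i * g k"
        then have "fst (st (n + i)) = k" "\<sigma> (n + i) = Some k"
          using Suc by (simp_all add: \<sigma>_def)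
        then show False
          using no by blast
      qed
      then show ?case
        using Suc by (simp add: st_Suc mult_ac)
    qed
    obtain i where i: "1 / g k < q ^ i"
      using real_arch_pow[OF assms(1)] by blast
    have "1 / g k \<le> 1 * q ^ i"
      using i by simp
    also have "\<dots> \<le> snd (st n) * q ^ i"
      using W[of n] assms(1) by (intro mult_right_mono) auto
    finally have "1 / g k \<le> snd (st n) * q ^ i" .
    then have "1 \<le> snd (st n) * q ^ i * g k"
      using assms(2)[of k] by (simp add: pos_divide_le_eq)
    then have "fst (st (n + i)) = k" "\<sigma> (n + i) = Some k"
      using *[of i] by (simp_all add: \<sigma>_def)
    then show False
      using no by blast
  qed
  have "\<exists>n. fst (st n) = k" for k
  proof (induction k)
    case 0
    then show ?case
      using st_0 by (metis fst_conv)
  next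
    case (Suc k)
    then obtain m where m: "fst (st m) = k" "\<sigma> m = Some k"
      using hit by blast
    then have "fst (st (Suc m)) = Suc k"
      by (auto simp: st_Suc \<sigma>_def split: prod.splits if_splits)
    then show ?case
      by blast
  qed
  then have "\<exists>n. \<sigma> n = Some k" for k
    using hit by blast
  then show thesis
    using that W by metis
qed

text \<open>The embeddings are chosen simultaneously for all centres and scales. Normalising to
  \<open>a \<le> 1\<close> makes r/a dominate r when distances are added later.\<close>

lemma uniformly_self_embeddableE:
  assumes "uniformly_self_embeddable K"
  obtains a f where "0 < a" "a \<le> 1"
    "\<And>z r. z \<in> K \<Longrightarrow> 0 < r \<Longrightarrow> r \<le> diameter K \<Longrightarrow> f z r ` K \<subseteq> cball z r \<inter> K"
    "\<And>z r x y. z \<in> K \<Longrightarrow> 0 < r \<Longrightarrow> r \<le> diameter K \<Longrightarrow> x \<in> K \<Longrightarrow> y \<in> K \<Longrightarrow>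
      a * r * dist x y \<le> dist (f z r x) (f z r y) \<and> dist (f z r x) (f z r y) \<le> r / a * dist x y"
proof -
  obtain b where b: "b > 0" "\<And>z r. z \<in> K \<Longrightarrow> 0 < r \<Longrightarrow> r \<le> diameter K \<Longrightarrow> embeds_at_scale K z r b"
    using assms unfolding uniformly_self_embeddable_def by blast
  define a where "a = min b 1"
  have a: "0 < a" "a \<le> 1" "a \<le> b"
    using b(1) by (auto simp: a_def)
  have "\<exists>f. f ` K \<subseteq> cball z r \<inter> K \<and> (\<forall>x\<in>K. \<forall>y\<in>K. a * r * dist x y \<le> dist (f x) (f y) \<and>
      dist (f x) (f y) \<le> r / a * dist x y)" if zr: "z \<in> K" "0 < r" "r \<le> diameter K" for z r
  proof -
    obtain f where f: "f ` K \<subseteq> cball z r \<inter> K" "\<And>x y. x \<in> K \<Longrightarrow> y \<in> K \<Longrightarrow> b * r * dist x y \<le> dist (f x) (f y)"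
      "\<And>x y. x \<in> K \<Longrightarrow> y \<in> K \<Longrightarrow> dist (f x) (f y) \<le> inverse b * r * dist x y"
      using b(2)[OF zr] unfolding embeds_at_scale_def by blast
    have "a * r * dist x y \<le> b * r * dist x y" "inverse b * r * dist x y \<le> r / a * dist x y" for x y
      using a zr b(1) by (auto intro!: mult_right_mono simp: field_simps)
    then show ?thesis
      using f by (intro exI[of _ f] conjI ballI) (blast intro: order_trans)+
  qed
  then obtain f where "\<And>z r. z \<in> K \<Longrightarrow> 0 < r \<Longrightarrow> r \<le> diameter K \<Longrightarrow>
      f z r ` K \<subseteq> cball z r \<inter> K \<and> (\<forall>x\<in>K. \<forall>y\<in>K. a * r * dist x y \<le> dist (f z r x) (f z r y) \<and>
      dist (f z r x) (f z r y) \<le> r / a * dist x y)"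
    by metis
  then show thesis
    using that[of a f] a by simp
qed

text \<open>An ordinary level replaces each point by the image of the separated set
  \<open>X\<close>; a sparse level replaces it by the image of the centre \<open>y k\<close> alone
  and shrinks the scale so much that the limit set stays beside the image of the thick ball. As each
  level embeds K directly rather than composing earlier embeddings, the distortion never exceeds
  that of a single embedding.\<close>

lemma hausdorff_measure_thick_tangents:
  fixes K :: "'a::euclidean_space set" and f :: "'a \<Rightarrow> real \<Rightarrow> 'a \<Rightarrow> 'a"
  assumes "compact K" "locally_self_embeddable K" "0 < diameter K" "0 < a" "a \<le> 1"
    and f: "\<And>z r. z \<in> K \<Longrightarrow> 0 < r \<Longrightarrow> r \<le> diameter K \<Longrightarrow> f z r ` K \<subseteq> cball z r \<inter> K"
    and f_dist: "\<And>z r x y. z \<in> K \<Longrightarrow> 0 < r \<Longrightarrow> r \<le> diameter K \<Longrightarrow> x \<in> K \<Longrightarrow> y \<in> K \<Longrightarrow>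
      a * r * dist x y \<le> dist (f z r x) (f z r y) \<and> dist (f z r x) (f z r y) \<le> r / a * dist x y"
    and u: "0 \<le> u" "ereal u < hausdorff_dim K"
  shows "hausdorff_measure u {x\<in>K. \<exists>F\<in>Tan K x.
    hausdorff_measure (assouad_dim K) F \<ge> ennreal ((a\<^sup>2 / 2) powr assouad_dim K)} \<noteq> 0"
proof -
  have "K \<noteq> {}"
    using assms(3) by auto
  then obtain z\<^sub>0 where z0: "z\<^sub>0 \<in> K"
    by blast
  obtain \<delta> X where \<delta>: "0 < \<delta>" "\<delta> \<le> 1" and X: "finite X" "X \<subseteq> K"
    "\<And>x y. x \<in> X \<Longrightarrow> y \<in> X \<Longrightarrow> x \<noteq> y \<Longrightarrow> \<delta> \<le> dist x y" "1 < real (card X) * (a / 8 * \<delta>) powr u"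
    using separated_set_exists[OF u, of "a / 8"] assms(4) by auto
  \<comment> \<open>An embedding at scale \<rho> keeps the points of \<open>X\<close> at least a
    \<rho> \<delta> apart, which is 8 times the next scale \<rho> \<theta>.\<close>
  define \<theta> where "\<theta> = a / 8 * \<delta>"
  have \<theta>: "0 < \<theta>" "\<theta> \<le> 1 / 2"
  proof -
    show "0 < \<theta>"
      using \<delta> assms by (simp add: \<theta>_def)
    have "a / 8 * \<delta> \<le> 1 / 2 * 1"
      using \<delta> assms by (intro mult_mono) auto
    then show "\<theta> \<le> 1 / 2"
      by (simp add: \<theta>_def)
  qed
  have "\<forall>k. \<exists>y R. thick_ball K k y R"
    using thick_ball_near[OF assms(1,2) z0, of 1] by (metis zero_less_one)
  then obtain y R where yR: "\<And>k. thick_ball K k (y k) (R k)"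
    by metis
  have y: "\<And>k. y k \<in> K" and R: "\<And>k. 0 < R k" "\<And>k. R k < 1 / real (Suc k)"
    and thick: "\<And>k. thick (1 / real (Suc k)) (assouad_dim K - 1 / real (Suc k)) (R k) (cball (y k) (R k) \<inter> K)"
    using yR unfolding thick_ball_def by auto
  obtain \<sigma> :: "nat \<Rightarrow> nat option" where \<sigma>: "\<And>k. \<exists>n. \<sigma> n = Some k"
    "\<And>n. 1 \<le> (\<Prod>j<n. case \<sigma> j of None \<Rightarrow> real (card X) * \<theta> powr u | Some k \<Rightarrow> (R k / 2) powr u)"
  proof (rule schedule_exists[of "real (card X) * \<theta> powr u" "\<lambda>k. (R k / 2) powr u"])
    show "1 < real (card X) * \<theta> powr u"
      using X by (simp add: \<theta>_def)
    show "0 < (R k / 2) powr u" for k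
      using R(1)[of k] by simp
  qed (rule that)
  \<comment> \<open>With ratio \<open>R k / 2\<close>, the drift 2\<rho>(n+1) after a sparse level
    is \<rho>(n) \<open>R k\<close>, comparable to the size of the transported thick ball.\<close>
  define \<tau> where "\<tau> n = (case \<sigma> n of None \<Rightarrow> \<theta> | Some k \<Rightarrow> R k / 2)" for n
  define Y where "Y n = (case \<sigma> n of None \<Rightarrow> X | Some k \<Rightarrow> {y k})" for n
  \<comment> \<open>The embeddings exist for scales up to the diameter; the bound 1 makes the radii
    \<open>T k\<close> below tend to 0.\<close>
  define \<rho>\<^sub>0 where "\<rho>\<^sub>0 = min 1 (diameter K)"
  define \<rho> where "\<rho> n = \<rho>\<^sub>0 * (\<Prod>j<n. \<tau> j)" for n
  have \<tau>: "0 < \<tau> n" "\<tau> n \<le> 1 / 2" for n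
  proof -
    have "R k \<le> 1" for k
      proof -
      have "R k < 1 / real (Suc k)"
        by (rule R(2))
      also have "\<dots> \<le> 1"
        by simp
      finally show ?thesis
        by simp
    qed
    then show "0 < \<tau> n" "\<tau> n \<le> 1 / 2"
      using \<theta> R(1) by (auto simp: \<tau>_def split: option.splits)
  qed
  have \<rho>0: "0 < \<rho>\<^sub>0"
    using assms by (simp add: \<rho>\<^sub>0_def)
  have \<rho>_Suc: "\<rho> (Suc n) = \<rho> n * \<tau> n" for n
    by (simp add: \<rho>_def)
  have \<rho>_pos: "0 < \<rho> n" for n
    using \<rho>0 \<tau> by (simp add: \<rho>_def prod_pos)
  have \<rho>_half: "\<rho> (Suc n) \<le> \<rho> n / 2" for n
    using mult_left_mono[OF \<tau>(2)[of n], of "\<rho> n"] \<rho>_pos[of n] by (simp add: \<rho>_Suc)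
  have "\<rho> n \<le> \<rho>\<^sub>0" for n
  proof (induction n)
    case (Suc n)
    then show ?case
      using \<rho>_half[of n] \<rho>_pos[of n] by simp
  qed (simp add: \<rho>_def)
  then have scale_le: "\<rho> n \<le> diameter K" "\<rho> n \<le> 1" for n
    using order_trans by (fastforce simp: \<rho>\<^sub>0_def)+
  note emb = f[OF _ \<rho>_pos scale_le(1)] and emb_dist = f_dist[OF _ \<rho>_pos scale_le(1)]
  have card_X: "card X \<ge> 1"
    using X(4) by (cases "card X") auto
  have Y: "finite (Y n)" "Y n \<subseteq> K" for n
    using X y by (auto simp: Y_def split: option.splits)
  have Y_separated: "8 * \<tau> n \<le> a * dist v w" if "v \<in> Y n" "w \<in> Y n" "v \<noteq> w" for n v w
    using that X(3)[of v w] assms(4) by (auto simp: Y_def \<tau>_def \<theta>_def split: option.splits)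
  have image_separated: "8 * \<rho> (Suc n) \<le> dist (f z (\<rho> n) v) (f z (\<rho> n) w)"
    if "z \<in> K" "v \<in> Y n" "w \<in> Y n" "v \<noteq> w" for n z v w
  proof -
    have "8 * \<rho> (Suc n) = \<rho> n * (8 * \<tau> n)"
      by (simp add: \<rho>_Suc)
    also have "\<dots> \<le> \<rho> n * (a * dist v w)"
      using Y_separated[OF that(2-4)] \<rho>_pos[of n] by (intro mult_left_mono) auto
    also have "\<dots> = a * \<rho> n * dist v w"
      by simp
    also have "\<dots> \<le> dist (f z (\<rho> n) v) (f z (\<rho> n) w)"
      using emb_dist[OF that(1)] Y(2) that by blast
    finally show ?thesis .
  qed
  have inj: "inj_on (f z (\<rho> n)) (Y n)" if "z \<in> K" for z n
  proof (rule inj_onI)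
    fix v w assume "v \<in> Y n" "w \<in> Y n" "f z (\<rho> n) v = f z (\<rho> n) w"
    then show "v = w"
      using image_separated[OF that, of v n w] \<rho>_pos[of "Suc n"] by force
  qed
  interpret cantor_tree K "\<lambda>n z. f z (\<rho> n) ` Y n" \<rho> "\<lambda>n. card (Y n)" z\<^sub>0 u "\<rho>\<^sub>0 powr u" "real (card X)"
  proof
    show "compact K" "z\<^sub>0 \<in> K" "0 \<le> u" "0 < \<rho>\<^sub>0 powr u"
      using assms z0 \<rho>0 by auto
    show "0 < \<rho> n" "\<rho> (Suc n) \<le> \<rho> n / 2" for n
      by (rule \<rho>_pos \<rho>_half)+
    show "1 \<le> card (Y n)" "real (card (Y n)) \<le> real (card X)" for n
      using card_X by (auto simp: Y_def split: option.splits)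
    show "f z (\<rho> n) ` Y n \<subseteq> K \<inter> cball z (\<rho> n)" if "z \<in> K" for n z
      using emb[OF that, of n] Y(2)[of n] by blast
    show "finite (f z (\<rho> n) ` Y n)" "card (f z (\<rho> n) ` Y n) = card (Y n)" if "z \<in> K" for n z
      using Y(1) inj[OF that] by (auto intro: card_image)
    show "8 * \<rho> (Suc n) \<le> dist v w"
      if "z \<in> K" "v \<in> f z (\<rho> n) ` Y n" "w \<in> f z (\<rho> n) ` Y n" "v \<noteq> w" for n z v w
      using image_separated[OF that(1)] that(2-4) by blast
    show "\<rho>\<^sub>0 powr u \<le> real (\<Prod>j<n. card (Y j)) * \<rho> n powr u" for n
    proof -
      \<comment> \<open>Each scheduled factor is exactly the number of children times the
        contraction to the power u, so the schedule is the mass condition.\<close>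
      have "(case \<sigma> j of None \<Rightarrow> real (card X) * \<theta> powr u | Some k \<Rightarrow> (R k / 2) powr u) =
          real (card (Y j)) * \<tau> j powr u" for j
        by (simp add: Y_def \<tau>_def split: option.splits)
      then have "1 \<le> (\<Prod>j<n. real (card (Y j)) * \<tau> j powr u)"
        using \<sigma>(2)[of n] by simp
      also have "\<dots> = real (\<Prod>j<n. card (Y j)) * (\<Prod>j<n. \<tau> j) powr u"
        using \<tau> by (simp add: prod.distrib prod_powr_distrib less_imp_le)
      finally have "\<rho>\<^sub>0 powr u * 1 \<le> \<rho>\<^sub>0 powr u * (real (\<Prod>j<n. card (Y j)) * (\<Prod>j<n. \<tau> j) powr u)"
        by (intro mult_left_mono) auto
      then show ?thesis
        by (simp add: \<rho>_def powr_mult mult_ac)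
    qed
  qed
  let ?G = "{x\<in>K. \<exists>F\<in>Tan K x. ennreal ((a\<^sup>2 / 2) powr assouad_dim K) \<le> hausdorff_measure (assouad_dim K) F}"
  have "limit_set \<subseteq> ?G"
  proof
    fix x assume x: "x \<in> limit_set"
    then have xK: "x \<in> K"
      using limit_set_subset by blast
    obtain n where n: "\<And>k. \<sigma> (n k) = Some k"
      using \<sigma>(1) by metis
    \<comment> \<open>A transported point is within \<rho> R / a of the image of the centre, which
      is within \<rho> R of \<open>x\<close>; their sum is at most 2 \<rho> R / a.\<close>
    define T where "T k = 2 * \<rho> (n k) * R k / a" for k
    have T: "0 < T k" for k
      using \<rho>_pos R(1) assms by (simp add: T_def)
    have "\<exists>F\<in>Tan K x. ennreal ((a\<^sup>2 / 2) powr assouad_dim K) \<le> hausdorff_measure (assouad_dim K) F"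
    proof (rule tangent_of_thick[OF assms(1) xK])
      show "0 \<le> assouad_dim K"
        using \<open>K \<noteq> {}\<close> by (rule assouad_dim_nonneg)
      show "0 < 1 / T k" for k
        using T by simp
      show "filterlim (\<lambda>k. 1 / T k) at_top sequentially"
      proof (rule inverse_scales_at_top[OF T])
        fix k
        have "\<rho> (n k) * R k \<le> 1 * (1 / real (Suc k))"
          using scale_le(2) \<rho>_pos R by (intro mult_mono) (auto intro: less_imp_le)
        then have "2 * (\<rho> (n k) * R k) / a \<le> 2 * (1 / real (Suc k)) / a"
          using assms by (intro divide_right_mono) auto
        then show "T k \<le> 2 / a / real (Suc k)"
          by (simp add: T_def mult_ac)
      qed
      show "0 < a\<^sup>2 / 2"
        using assms by simp
      fix k
      let ?r = "\<rho> (n k)"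
      obtain z w where z: "z \<in> K" "w \<in> f z ?r ` Y (n k)" "dist x w \<le> 2 * \<rho> (Suc (n k))"
        using limit_set_near[OF x] by blast
      have w: "w = f z ?r (y k)"
        using z(2) n by (simp add: Y_def)
      have near: "dist x w \<le> ?r * R k"
        using z(3) n by (simp add: \<rho>_Suc \<tau>_def)
      let ?A = "f z ?r ` (cball (y k) (R k) \<inter> K)"
      have "thick (1 / real (Suc k)) (assouad_dim K - 1 / real (Suc k)) (a * ?r * R k) ?A"
      proof (rule thick_image[OF thick])
        show "a * ?r * dist v v' \<le> dist (f z ?r v) (f z ?r v')"
          if "v \<in> cball (y k) (R k) \<inter> K" "v' \<in> cball (y k) (R k) \<inter> K" for v v'
          using emb_dist[OF z(1)] that by blast
      qed (use assms \<rho>_pos R in auto)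
      then have "thick (1 / real (Suc k)) (assouad_dim K - 1 / real (Suc k)) (a * ?r * R k / T k)
          ((\<lambda>y. (1 / T k) *\<^sub>R (y - x)) ` K \<inter> cball 0 1)"
      proof (rule thick_blow_up)
        show "?A \<subseteq> K"
          using emb[OF z(1)] by blast
        show "?A \<subseteq> cball x (T k)"
        proof
          fix p assume "p \<in> ?A"
          then obtain v where v: "v \<in> K" "dist (y k) v \<le> R k" "p = f z ?r v"
            by auto
          have "dist w p \<le> ?r / a * dist (y k) v"
            using emb_dist[OF z(1) y v(1)] v(3) w by simp
          also have "\<dots> \<le> ?r / a * R k"
            using v \<rho>_pos[of "n k"] assms by (intro mult_left_mono) auto
          finally have "dist w p \<le> ?r * R k / a"
            by simp
          moreover have "?r * R k \<le> ?r * R k / a"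
            using assms(4,5) \<rho>_pos[of "n k"] R(1)[of k] by (simp add: pos_le_divide_eq)
          ultimately have "dist x p \<le> T k"
            using near dist_triangle[of x p w] by (simp add: T_def)
          then show "p \<in> cball x (T k)"
            by simp
        qed
      qed (use assms \<rho>_pos R T in auto)
      moreover have "a * ?r * R k / T k = a\<^sup>2 / 2"
        using \<rho>_pos[of "n k"] R(1)[of k] assms by (simp add: T_def power2_eq_square)
      ultimately show "thick (1 / real (Suc k)) (assouad_dim K - 1 / real (Suc k)) (a\<^sup>2 / 2)
          ((\<lambda>y. (1 / T k) *\<^sub>R (y - x)) ` K \<inter> cball 0 1)"
        by simp
    qed
    then show "x \<in> ?G"
      using xK by simp
  qed
  then have "hausdorff_measure u limit_set \<le> hausdorff_measure u ?G"
    by (rule hausdorff_measure_mono)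
  then show ?thesis
    using hausdorff_measure_limit_set by auto
qed

text \<open>The Cantor set depends on u but the constant only on \<open>a\<close> and
  \<open>assouad_dim K\<close>. One fixed set of points thus has non-zero u-dimensional measure for
  every non-negative u below dim_H K.\<close>

lemma hausdorff_dim_thick_tangents:
  fixes K :: "'a::euclidean_space set"
  assumes "compact K" "locally_self_embeddable K" "uniformly_self_embeddable K"
  obtains c where "0 < c" "hausdorff_dim {x\<in>K. \<exists>F\<in>Tan K x. hausdorff_measure (assouad_dim K) F \<ge> ennreal c}
    = hausdorff_dim K"
proof -
  obtain a f where a: "0 < a" "a \<le> 1"
    and f: "\<And>z r. z \<in> K \<Longrightarrow> 0 < r \<Longrightarrow> r \<le> diameter K \<Longrightarrow> f z r ` K \<subseteq> cball z r \<inter> K"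
    "\<And>z r x y. z \<in> K \<Longrightarrow> 0 < r \<Longrightarrow> r \<le> diameter K \<Longrightarrow> x \<in> K \<Longrightarrow> y \<in> K \<Longrightarrow>
      a * r * dist x y \<le> dist (f z r x) (f z r y) \<and> dist (f z r x) (f z r y) \<le> r / a * dist x y"
    using uniformly_self_embeddableE[OF assms(3)] by metis
  define c where "c = (a\<^sup>2 / 2) powr assouad_dim K"
  have "c > 0"
    using a by (simp add: c_def)
  let ?G = "{x\<in>K. \<exists>F\<in>Tan K x. hausdorff_measure (assouad_dim K) F \<ge> ennreal c}"
  have "hausdorff_dim K \<le> ereal u" if u: "0 \<le> u" "hausdorff_measure u ?G = 0" for u
  proof (rule ccontr)
    assume "\<not> ?thesis"
    then have less: "ereal u < hausdorff_dim K"
      by simp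
    \<comment> \<open>Otherwise K has at most one point, and a separated set of at most one point
      cannot satisfy the strict inequality of \<open>separated_set_exists\<close>.\<close>
    have "0 < diameter K"
    proof (rule ccontr)
      assume diam: "\<not> 0 < diameter K"
      have eq: "x = y" if "x \<in> K" "y \<in> K" for x y
      proof -
        have "dist x y = 0"
          using diameter_bounded_bound[OF compact_imp_bounded[OF assms(1)] that] diam zero_le_dist[of x y]
          by linarith
        then show ?thesis
          by simp
      qed
      obtain \<delta> X where X: "0 < \<delta>" "\<delta> \<le> 1" "finite X" "X \<subseteq> K" "1 < real (card X) * (1 * \<delta>) powr u"
        using separated_set_exists[OF u(1) less, of 1] by auto
      have "card X \<le> 1"
        using X(3,4) eq by (auto simp: card_le_Suc0_iff_eq subset_iff)
      moreover have "(1 * \<delta>) powr u \<le> 1"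
        using X u(1) by (intro powr_le1) auto
      ultimately have "real (card X) * (1 * \<delta>) powr u \<le> 1 * 1"
        by (intro mult_mono) auto
      then show False
        using X(5) by simp
    qed
    then show False
      using hausdorff_measure_thick_tangents[OF assms(1,2) _ a f u(1) less] u(2) by (simp add: c_def)
  qed
  then have "hausdorff_dim K \<le> hausdorff_dim ?G"
    unfolding hausdorff_dim_def[of ?G] by (intro INF_greatest) auto
  moreover have "hausdorff_dim ?G \<le> hausdorff_dim K"
    by (intro hausdorff_dim_mono) auto
  ultimately show thesis
    using that[OF \<open>c > 0\<close>] by (simp add: antisym)
qed

theorem theoremC:
  fixes K :: "(real ^ 'n) set"
  assumes "K \<noteq> {}" and "compact K" and "self_embeddable K"
  shows "(\<forall>x\<in>K. upper_box_dim K \<le> ereal (pointwise_assouad_dim K x))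
    \<and> (\<exists>P\<subseteq>K. K \<subseteq> closure P \<and>
         (\<forall>x\<in>P. \<exists>F\<in>Tan K x.
            hausdorff_measure (assouad_dim K) F \<ge> ennreal (2 powr (- assouad_dim K))))
    \<and> packing_dim {x\<in>K. pointwise_assouad_dim K x = assouad_dim K} = packing_dim K
    \<and> (uniformly_self_embeddable K \<longrightarrow>
         (\<exists>c>0. hausdorff_dim {x\<in>K. \<exists>F\<in>Tan K x.
                  hausdorff_measure (assouad_dim K) F \<ge> ennreal c} = hausdorff_dim K))"
proof -
  have loc: "locally_self_embeddable K"
    using assms by (intro self_embeddable_imp_local compact_imp_bounded)
  \<comment> \<open>The same residual set gives the tangents and, directly through covering numbers,
    the pointwise dimension needed for the packing statement.\<close>
  define P where "P = (\<Inter>m. near_thick_ball K m)"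
  have PK: "P \<subseteq> K"
    using near_thick_ball_subset[of K 0] by (auto simp: P_def)
  have dense: "K \<subseteq> closure P"
    unfolding P_def using openin_near_thick_ball near_thick_ball_dense[OF assms(2) loc]
    by (intro Baire compact_imp_closed assms(2)) auto
  have P: "x \<in> near_thick_ball K m" if "x \<in> P" for x m
    using that by (auto simp: P_def)
  have tangents: "\<exists>F\<in>Tan K x. ennreal (2 powr (- assouad_dim K)) \<le> hausdorff_measure (assouad_dim K) F"
    if "x \<in> P" for x
    using tangent_near_thick_balls[OF assms(2) _ P[OF that]] that PK by blast
  have "packing_dim {x\<in>K. pointwise_assouad_dim K x = assouad_dim K} = packing_dim K"
  proof (rule packing_dim_residual[OF assms(1,2) loc])
    show "openin (top_of_set K) (near_thick_ball K m)" "K \<subseteq> closure (near_thick_ball K m)" for m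
      by (rule openin_near_thick_ball near_thick_ball_dense[OF assms(2) loc])+
    show "(\<Inter>m. near_thick_ball K m) \<subseteq> {x\<in>K. pointwise_assouad_dim K x = assouad_dim K}"
      unfolding P_def[symmetric] using pointwise_assouad_dim_near_thick_balls[OF _ P] PK by blast
  qed auto
  moreover have "\<exists>c>0. hausdorff_dim {x\<in>K. \<exists>F\<in>Tan K x.
      hausdorff_measure (assouad_dim K) F \<ge> ennreal c} = hausdorff_dim K"
    if "uniformly_self_embeddable K"
    by (rule hausdorff_dim_thick_tangents[OF assms(2) loc that]) blast
  moreover have "\<forall>x\<in>K. upper_box_dim K \<le> ereal (pointwise_assouad_dim K x)"
    using upper_box_dim_le_pointwise_assouad_dim[OF assms(2) loc] by blast
  moreover have "\<exists>P\<subseteq>K. K \<subseteq> closure P \<and> (\<forall>x\<in>P. \<exists>F\<in>Tan K x.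
      hausdorff_measure (assouad_dim K) F \<ge> ennreal (2 powr (- assouad_dim K)))"
    using PK dense tangents by (intro exI[of _ P]) simp
  ultimately show ?thesis
    by (intro conjI impI)
qed

end
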